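(* Let $\mathcal{G}$ be a connected, simple, undirected graph with a fixed ribbon structure and basis $(b_0,b_0b_1)$, and let $\mathcal{J}(\mathcal{G})$ be the set of all pairs $(G,T)$ with $G$ a facet graph of $\mathcal{G}$ and $T$ a Jaeger tree of $G$. Then the quadratic order $<_4$ is a shelling order of the collection of simplices $\mathcal{Q}_T=\mathrm{conv}\{\mathbf{v}-\mathbf{u}:\overrightarrow{uv}\in T\}$, $(G,T)\in\mathcal{J}(\mathcal{G})$ (which form a dissection of the boundary of $P_{\mathcal{G}}$).
   Context: For $v\in V$, $\mathbf{v}$ is the standard basis vector of $\mathbb{R}^V$; $P_{\mathcal{G}}=\mathrm{conv}\{\mathbf{u}-\mathbf{v},\mathbf{v}-\mathbf{u}: uv\in E(\mathcal{G})\}$. A layering is $l:V\to\mathbb{Z}$ with $|l(u)-l(v)|\le1$ for all edges $uv$ such that $E_l=\{uv:|l(u)-l(v)|=1\}$ forms a connected spanning subgraph; its facet graph $G$ is $(V,E_l)$ with $uv$ oriented from $u$ (tail) to $v$ (head), written $\overrightarrow{uv}$, when $l(v)-l(u)=1$. Edges of $\mathcal{G}$ not in $G$ are hidden in $G$. Ribbon structure: for each vertex $x$ a cyclic order of incident edges of $\mathcal{G}$; $xy^+$ is the edge after $xy$ at $x$. Basis: vertex $b_0$ and edge $b_0b_1$ of $\mathcal{G}$. For a spanning tree $T$ of a facet graph, its tour is taken in $\mathcal{G}$: start at $(b_0,b_0b_1)$; from $(x,xy)$ go to $(x,xy^+)$ if $xy\notin T$ and to $(y,yx^+)$ if $xy\in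 T$; stop just before $(b_0,b_0b_1)$ recurs. $T$ is a Jaeger tree of $G$ if every edge $\overrightarrow{th}$ of $G$ not in $T$ has $(t,th)$ current before $(h,th)$ in the tour (hidden edges are disregarded). $\overrightarrow{th}\in T$ is a tail-edge if $t$ and $b_0$ lie in the same component of $T-th$. Quadratic order: at a current pair $(u,uv)$ of the tour of $T$ (a Jaeger tree of $G$), the status of $uv$ is one of: (1) $\overrightarrow{vu}\in T$; (2) $uv$ hidden in $G$; (3) $\overrightarrow{uv}\in G$ but $\notin T$; (4) $\overrightarrow{uv}\in T$; (5) $\overrightarrow{vu}\in G\setminus T$. For distinct $(G,T),(G',T')\in\mathcal{J}(\mathcal{G})$, compare their tours until the first step at which the current edge has different status for the two trees (up to that step the node-edge pairs coincide); at this step (which is a common pair $(u,uv)$, and status (5) cannot occur there for either tree), the tree whose status has the smaller number is smaller in $<_4$. A shelling order of a dissection of the boundary into $(|V|-2)$-simplices is an ordering $\sigma_1,\dots,\sigma_N$ such that for each $i\ge2$, $\sigma_i\cap\bigcup_{j<i}\sigma_j$ is the union of a positive number of facets of $\sigma_i$. *)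

theory Defs
  imports "HOL-Analysis.Analysis" "HOL-Combinatorics.Orbits"
begin

text \<open>
  The vertex set of a graph is a finite type \<open>'v\<close>, so that \<open>\<real>\<^sup>V\<close> is \<open>real ^ 'v\<close>.
  An undirected simple graph is a symmetric irreflexive relation; facet graphs and their
  spanning trees are oriented and are represented by their sets of arcs \<open>(tail, head)\<close>.
  For an arc set \<open>A\<close>, the relation \<open>A \<union> A\<inverse>\<close> is the underlying undirected graph.
\<close>

definition simple_graph :: "'v rel \<Rightarrow> bool" where
  "simple_graph E \<longleftrightarrow> sym E \<and> irrefl E"

definition connected_spanning :: "'v rel \<Rightarrow> bool" where
  "connected_spanning A \<longleftrightarrow> (\<forall>u v. (u, v) \<in> (A \<union> A\<inverse>)\<^sup>*)"

text \<open>
  Cycles of the underlying undirected graph (directed acyclicity would be vacuous: layerings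
  make facet graphs acyclic as digraphs). Length 2 need not be considered, since facet graphs
  have no antiparallel arcs.
\<close>

definition undirected_cycle :: "'v rel \<Rightarrow> 'v list \<Rightarrow> bool" where
  "undirected_cycle A xs \<longleftrightarrow> 3 \<le> length xs \<and> distinct xs \<and>
     (\<forall>i<length xs. (xs ! i, xs ! (Suc i mod length xs)) \<in> A \<union> A\<inverse>)"

definition spanning_tree :: "'v rel \<Rightarrow> 'v rel \<Rightarrow> bool" where
  "spanning_tree T G \<longleftrightarrow> T \<subseteq> G \<and> connected_spanning T \<and> (\<nexists>xs. undirected_cycle T xs)"

definition root_polytope :: "'v rel \<Rightarrow> (real ^ 'v::finite) set" where
  "root_polytope E = convex hull
     (\<Union>(u, v)\<in>E. {axis u 1 - axis v 1, axis v 1 - axis u 1})"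

definition arc_polytope :: "'v rel \<Rightarrow> (real ^ 'v::finite) set" where
  "arc_polytope T = convex hull {axis v 1 - axis u 1 | u v. (u, v) \<in> T}"

definition layering :: "'v rel \<Rightarrow> ('v \<Rightarrow> int) \<Rightarrow> bool" where
  "layering E l \<longleftrightarrow> (\<forall>(u, v)\<in>E. \<bar>l u - l v\<bar> \<le> 1) \<and>
     connected_spanning {(u, v) \<in> E. \<bar>l u - l v\<bar> = 1}"

definition facet_graphs :: "'v rel \<Rightarrow> 'v rel set" where
  "facet_graphs E = {{(u, v) \<in> E. l v - l u = 1} | l. layering E l}"

text \<open>
  As the graph is simple, an edge incident to \<open>x\<close> is given by its other endpoint: \<open>rot x\<close>
  maps a neighbour \<open>y\<close> to the \<open>z\<close> with \<open>xy\<^sup>+ = xz\<close>, and a node-edge pair \<open>(x, xy)\<close> is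
  written \<open>(x, y)\<close>.
\<close>

definition ribbon_structure :: "'v rel \<Rightarrow> ('v \<Rightarrow> 'v \<Rightarrow> 'v) \<Rightarrow> bool" where
  "ribbon_structure E rot \<longleftrightarrow> (\<forall>x. E `` {x} \<noteq> {} \<longrightarrow> cyclic_on (rot x) (E `` {x}))"

definition tour_step :: "('v \<Rightarrow> 'v \<Rightarrow> 'v) \<Rightarrow> 'v rel \<Rightarrow> 'v \<times> 'v \<Rightarrow> 'v \<times> 'v" where
  "tour_step rot T = (\<lambda>(x, y). if (x, y) \<in> T \<union> T\<inverse> then (y, rot y x) else (x, rot x y))"

definition tour_length :: "('v \<Rightarrow> 'v \<Rightarrow> 'v) \<Rightarrow> 'v \<times> 'v \<Rightarrow> 'v rel \<Rightarrow> nat" where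
  "tour_length rot b T = (LEAST n. 0 < n \<and> (tour_step rot T ^^ n) b = b)"

definition tour :: "('v \<Rightarrow> 'v \<Rightarrow> 'v) \<Rightarrow> 'v \<times> 'v \<Rightarrow> 'v rel \<Rightarrow> ('v \<times> 'v) list" where
  "tour rot b T = map (\<lambda>k. (tour_step rot T ^^ k) b) [0..<tour_length rot b T]"

definition jaeger_tree :: "('v \<Rightarrow> 'v \<Rightarrow> 'v) \<Rightarrow> 'v \<times> 'v \<Rightarrow> 'v rel \<Rightarrow> 'v rel \<Rightarrow> bool" where
  "jaeger_tree rot b G T \<longleftrightarrow> spanning_tree T G \<and>
     (\<forall>(t, h)\<in>G - T. \<exists>i j. i < j \<and> j < length (tour rot b T) \<and>
        tour rot b T ! i = (t, h) \<and> tour rot b T ! j = (h, t))"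

definition jaeger_pairs ::
    "'v rel \<Rightarrow> ('v \<Rightarrow> 'v \<Rightarrow> 'v) \<Rightarrow> 'v \<times> 'v \<Rightarrow> ('v rel \<times> 'v rel) set" where
  "jaeger_pairs E rot b = {(G, T). G \<in> facet_graphs E \<and> jaeger_tree rot b G T}"

text \<open>
  Status 5, \<open>(v, u) \<in> G - T\<close>, never occurs at the first difference of two Jaeger trees;
  it is only needed to state where that first difference is.
\<close>

definition edge_status :: "'v rel \<times> 'v rel \<Rightarrow> 'v \<times> 'v \<Rightarrow> nat" where
  "edge_status = (\<lambda>(G, T) (u, v).
     if (v, u) \<in> T then 1
     else if (u, v) \<notin> G \<and> (v, u) \<notin> G then 2
     else if (u, v) \<in> G - T then 3
     else if (u, v) \<in> T then 4
     else 5)"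

definition quadratic_order ::
    "'v rel \<Rightarrow> ('v \<Rightarrow> 'v \<Rightarrow> 'v) \<Rightarrow> 'v \<times> 'v \<Rightarrow> ('v rel \<times> 'v rel) rel" where
  "quadratic_order E rot b = {(p, q).
     p \<in> jaeger_pairs E rot b \<and> q \<in> jaeger_pairs E rot b \<and>
     (let s = map (edge_status p) (tour rot b (snd p));
          s' = map (edge_status q) (tour rot b (snd q))
      in \<exists>k. k < length s \<and> k < length s' \<and> take k s = take k s' \<and> s ! k < s' ! k)}"

definition dissection :: "int \<Rightarrow> 'i set \<Rightarrow> ('i \<Rightarrow> 'a::euclidean_space set) \<Rightarrow> 'a set \<Rightarrow> bool" where
  "dissection d I Q X \<longleftrightarrow> finite I \<and> (\<forall>i\<in>I. d simplex Q i) \<and> (\<Union>i\<in>I. Q i) = X \<and>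
     pairwise (\<lambda>i j. rel_interior (Q i) \<inter> rel_interior (Q j) = {}) I"

text \<open>
  Unlike \<open>facet_of\<close>, this admits the empty set as the facet of a single point. This matters
  for a graph with two vertices, where the simplices are points.
\<close>

definition simplex_facet :: "'a::euclidean_space set \<Rightarrow> 'a set \<Rightarrow> bool" where
  "simplex_facet F \<sigma> \<longleftrightarrow> F face_of \<sigma> \<and> aff_dim F = aff_dim \<sigma> - 1"

definition shelling_order :: "'a::euclidean_space set list \<Rightarrow> bool" where
  "shelling_order \<sigma> \<longleftrightarrow> (\<forall>i. 1 \<le> i \<and> i < length \<sigma> \<longrightarrow>
     (\<exists>\<F>. \<F> \<noteq> {} \<and> (\<forall>F\<in>\<F>. simplex_facet F (\<sigma> ! i)) \<and>
        \<sigma> ! i \<inter> (\<Union>j<i. \<sigma> ! j) = \<Union>\<F>))"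

end

theory Submission
  imports Defs
begin

text \<open>
  In an oriented tree \<open>T\<close> the vectors \<open>\<^bold>v - \<^bold>u\<close> form a basis of the vectors of coordinate sum zero,
  and the coordinate of \<open>x\<close> at an arc is the sum of \<open>x\<close> over the head side of that arc. So a point
  of the cone over \<open>\<Q>\<^sub>T\<close> is a nonnegative flow on \<open>T\<close>, whose value on an arc is the net flow
  across the corresponding cut. A layering is a dual solution: on a point of its facet, it has
  difference 1 along every arc that carries flow.

  \<^item> Covering. A boundary point lies in the facet of some layering, and there in \<open>\<Q>\<^sub>T\<close> for some tree
    \<open>T\<close>. Take \<open>T\<close> with the lexicographically smallest sequence of statuses. If an arc outside \<open>T\<close> were
    visited at its head first, pushing flow along its fundamental cycle would give a smaller tree.
    Hence \<open>T\<close> is a Jaeger tree.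

  \<^item> Earlier simplices meet \<open>\<Q>\<^sub>T\<close> in tail-edge facets. Suppose that \<open>T'\<close> precedes \<open>T\<close>, and let \<open>uv\<close>
    be the first difference. If \<open>\<Q>\<^sub>T\<close> and \<open>\<Q>\<^sub>T'\<close> share a point with flow on \<open>uv \<in> T\<close>, then \<open>T'\<close> has
    another arc across the same cut; as \<open>T\<close> is a Jaeger tree, it was met, and rejected, before \<open>uv\<close>.
    Otherwise the layering of \<open>T'\<close> rises less along \<open>uv\<close> than that of \<open>T\<close>, which forces it to rise by
    less than 1 on some tail-edge. This also gives the disjointness of the interiors.

  \<^item> Tail-edge facets are covered earlier. Push a point of the relative interior of such a facet
    slightly out of \<open>\<Q>\<^sub>T\<close>; any simplex that covers the pushed points precedes \<open>\<Q>\<^sub>T\<close>.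
\<close>

subsection \<open>Flows on oriented trees\<close>

definition arc_vec :: "'v \<times> 'v \<Rightarrow> real ^ 'v::finite" where
  "arc_vec = (\<lambda>(u, v). axis v 1 - axis u 1)"

definition set_sum :: "'v set \<Rightarrow> real ^ 'v::finite \<Rightarrow> real" where
  "set_sum D x = (\<Sum>w\<in>D. x $ w)"

definition potential_value :: "('v \<Rightarrow> real) \<Rightarrow> real ^ 'v::finite \<Rightarrow> real" where
  "potential_value l x = (\<Sum>w\<in>UNIV. l w * x $ w)"

text \<open>One shore of the fundamental cut of the arc: what is still connected to its head once
  the arc is deleted. The tail lies on the other shore only if \<open>T\<close> is a tree.\<close>

definition head_side :: "'v rel \<Rightarrow> 'v \<times> 'v \<Rightarrow> 'v set" where
  "head_side T = (\<lambda>(u, v). ((T - {(u, v)}) \<union> (T - {(u, v)})\<inverse>)\<^sup>* `` {v})"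

text \<open>Acyclicity is put in terms of cuts, because the coordinates are cut sums;
  \<open>spanning_tree_iff\<close> reconciles this with the absence of undirected cycles.\<close>

definition oriented_tree :: "'v rel \<Rightarrow> bool" where
  "oriented_tree T \<longleftrightarrow> connected_spanning T \<and> (\<forall>e\<in>T. fst e \<notin> head_side T e)"

text \<open>The net flow across the fundamental cut of \<open>e\<close>. On balanced vectors these
  functionals are the dual basis of the arc vectors of a tree.\<close>

definition coord :: "'v rel \<Rightarrow> 'v \<times> 'v \<Rightarrow> real ^ 'v::finite \<Rightarrow> real" where
  "coord T e = set_sum (head_side T e)"

lemma arc_polytope_eq: "arc_polytope T = convex hull (arc_vec ` T)"
  unfolding arc_polytope_def arc_vec_def by (rule arg_cong[where f="(hull) convex"]) force

lemma linear_set_sum: "linear (set_sum D)"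
  by (rule linearI) (auto simp: set_sum_def sum.distrib sum_distrib_left)

lemma linear_potential_value: "linear (potential_value l)"
  by (rule linearI) (auto simp: potential_value_def sum.distrib sum_distrib_left algebra_simps)

lemma linear_coord: "linear (coord T e)"
  by (simp add: coord_def linear_set_sum)

lemma set_sum_axis: "set_sum D (axis v 1) = of_bool (v \<in> D)"
proof -
  have "set_sum D (axis v 1) = (\<Sum>w\<in>D. if w = v then 1 else 0)"
    unfolding set_sum_def by (intro sum.cong) (auto simp: axis_def)
  then show ?thesis by (simp add: sum.delta)
qed

lemma set_sum_arc_vec: "set_sum D (arc_vec (u, v)) = of_bool (v \<in> D) - of_bool (u \<in> D)"
  by (simp add: arc_vec_def linear_diff[OF linear_set_sum] set_sum_axis)

lemma potential_value_arc_vec: "potential_value l (arc_vec (u, v)) = l v - l u"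
proof -
  have "potential_value l (axis w 1) = l w" for w
  proof -
    have "potential_value l (axis w 1) = (\<Sum>z\<in>UNIV. if z = w then l w else 0)"
      unfolding potential_value_def by (intro sum.cong) (auto simp: axis_def)
    then show ?thesis by (simp add: sum.delta)
  qed
  then show ?thesis by (simp add: arc_vec_def linear_diff[OF linear_potential_value])
qed

lemma in_head_side: "(u, v) \<in> T \<Longrightarrow> v \<in> head_side T (u, v)"
  by (simp add: head_side_def)

lemma tail_notin_head_side: "oriented_tree T \<Longrightarrow> (u, v) \<in> T \<Longrightarrow> u \<notin> head_side T (u, v)"
  by (auto simp: oriented_tree_def)

text \<open>An arc other than \<open>e\<close> survives the deletion of \<open>e\<close>, so its
  ends stay in one component.\<close>

lemma head_side_crossing:
  assumes "(a, b) \<in> T" "(a, b) \<noteq> e"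
  shows "a \<in> head_side T e \<longleftrightarrow> b \<in> head_side T e"
proof -
  obtain u v where e: "e = (u, v)" by force
  let ?R = "(T - {(u, v)}) \<union> (T - {(u, v)})\<inverse>"
  have "(a, b) \<in> ?R" "(b, a) \<in> ?R" using assms e by auto
  then show ?thesis unfolding e head_side_def
    by (auto intro: rtrancl_into_rtrancl)
qed

lemma coord_arc_vec:
  assumes "oriented_tree T" "e \<in> T" "e' \<in> T"
  shows "coord T e (arc_vec e') = of_bool (e = e')"
proof -
  obtain a b where e': "e' = (a, b)" by force
  show ?thesis
  proof (cases "e = e'")
    case True
    then show ?thesis
      using assms in_head_side[of a b T] tail_notin_head_side[of T a b]
      by (simp add: e' coord_def set_sum_arc_vec)
  next
    case False
    then show ?thesis using head_side_crossing[of a b T e] assms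
      by (auto simp: e' coord_def set_sum_arc_vec)
  qed
qed

lemma coord_arc_vec_sides:
  "coord T e (arc_vec (u, v)) = of_bool (v \<in> head_side T e) - of_bool (u \<in> head_side T e)"
  by (simp add: coord_def set_sum_arc_vec)

section \<open>Spanning, independence and dimension of arc vectors\<close>

text \<open>Arc vectors telescope along a walk; an arc traversed backwards contributes its
  negative.\<close>

lemma rtrancl_arc_span:
  assumes "(a, b) \<in> (H \<union> H\<inverse>)\<^sup>*"
  shows "arc_vec (a, b) \<in> span (arc_vec ` H)"
  using assms
proof (induction rule: rtrancl_induct)
  case base
  then show ?case by (simp add: arc_vec_def span_zero)
next
  case (step y z)
  have "arc_vec (y, z) \<in> span (arc_vec ` H)"
  proof (cases "(y, z) \<in> H")
    case True
    then show ?thesis by (simp add: span_base)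
  next
    case False
    then have "arc_vec (z, y) \<in> span (arc_vec ` H)" using step by (auto simp: span_base)
    from span_neg[OF this] show ?thesis by (simp add: arc_vec_def)
  qed
  from span_add[OF step.IH this] show ?case by (simp add: arc_vec_def)
qed

text \<open>The contributions at \<open>r\<close> add up to minus the total of \<open>x\<close>,
  which vanishes.\<close>

lemma balanced_expansion:
  fixes x :: "real ^ 'v::finite"
  assumes "set_sum UNIV x = 0"
  shows "x = (\<Sum>w\<in>UNIV. x $ w *\<^sub>R arc_vec (r, w))"
proof -
  have "(\<Sum>w\<in>UNIV. x $ w *\<^sub>R arc_vec (r, w))
      = (\<Sum>w\<in>UNIV. x $ w *\<^sub>R axis w 1) - (\<Sum>w\<in>UNIV. x $ w) *\<^sub>R axis r 1"
    by (simp add: arc_vec_def scaleR_diff_right sum_subtractf scaleR_sum_left)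
  also have "(\<Sum>w\<in>UNIV. x $ w *\<^sub>R axis w 1) = x"
    using basis_expansion[of x] by (simp add: scalar_mult_eq_scaleR)
  finally show ?thesis using assms by (simp add: set_sum_def)
qed

lemma balanced_in_span:
  fixes x :: "real ^ 'v::finite"
  assumes "connected_spanning H" "set_sum UNIV x = 0"
  shows "x \<in> span (arc_vec ` H)"
proof -
  have "(\<Sum>w\<in>UNIV. x $ w *\<^sub>R arc_vec (undefined, w)) \<in> span (arc_vec ` H)"
    using assms(1) by (intro span_sum span_mul rtrancl_arc_span) (auto simp: connected_spanning_def)
  then show ?thesis using balanced_expansion[OF assms(2), of undefined] by simp
qed

lemma balanced_arc_vec: "set_sum UNIV (arc_vec e) = 0"
  by (cases e) (simp add: set_sum_arc_vec)

text \<open>Both sides are linear in \<open>x\<close> and agree on the arc vectors of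
  \<open>T\<close>, which span the balanced vectors.\<close>

lemma tree_expansion:
  fixes x :: "real ^ 'v::finite"
  assumes T: "oriented_tree T" and x: "set_sum UNIV x = 0"
  shows "x = (\<Sum>e\<in>T. coord T e x *\<^sub>R arc_vec e)"
proof -
  define F where "F x = (\<Sum>e\<in>T. coord T e x *\<^sub>R arc_vec e)" for x :: "real ^ 'v"
  have F: "linear F"
    unfolding F_def
    by (rule linearI) (simp_all add: linear_add[OF linear_coord] linear_scale[OF linear_coord]
        scaleR_add_left sum.distrib scaleR_sum_right)
  have F_arc: "F (arc_vec e) = arc_vec e" if "e \<in> T" for e
  proof -
    have "F (arc_vec e) = (\<Sum>e'\<in>T. if e' = e then arc_vec e else 0)"
      unfolding F_def using coord_arc_vec[OF T _ that] by (intro sum.cong) auto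
    then show ?thesis using that by (simp add: sum.delta)
  qed
  have "x \<in> span (arc_vec ` T)"
    using T x by (intro balanced_in_span) (auto simp: oriented_tree_def)
  then have "F x = x"
  proof (induction rule: span_induct)
    case base
    show ?case
      by (simp add: subspace_def linear_0[OF F] linear_add[OF F] linear_scale[OF F])
  next
    case (step y)
    then show ?case using F_arc by blast
  qed
  then show ?thesis by (simp add: F_def)
qed

text \<open>The means of comparing two trees: \<open>f\<close> will be a layering, a difference of
  layerings, or a cut of another tree, evaluated on a flow on \<open>T\<close>.\<close>

lemma linear_tree_expansion:
  fixes f :: "real ^ 'v::finite \<Rightarrow> real"
  assumes "oriented_tree T" "set_sum UNIV x = 0" "linear f"
  shows "f x = (\<Sum>e\<in>T. coord T e x * f (arc_vec e))"
proof -
  have "f x = f (\<Sum>e\<in>T. coord T e x *\<^sub>R arc_vec e)" using tree_expansion[OF assms(1,2)] by simp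
  then show ?thesis using assms(3) by (simp add: linear_sum linear_scale)
qed

lemma inj_on_arc_vec:
  assumes "oriented_tree T"
  shows "inj_on arc_vec T"
proof (rule inj_onI)
  fix e e' :: "'a \<times> 'a" assume e: "e \<in> T" "e' \<in> T" and "arc_vec e = arc_vec e'"
  then have "coord T e (arc_vec e) = coord T e (arc_vec e')" by simp
  then show "e = e'" using coord_arc_vec[OF assms e(1)] e by (simp split: if_splits)
qed

lemma sum_coord:
  assumes T: "oriented_tree T" and A: "A \<subseteq> T" and e: "e \<in> T"
  shows "coord T e (\<Sum>a\<in>A. c a *\<^sub>R arc_vec a) = (if e \<in> A then c e else 0)"
proof -
  have "coord T e (\<Sum>a\<in>A. c a *\<^sub>R arc_vec a) = (\<Sum>a\<in>A. c a * coord T e (arc_vec a))"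
    by (simp add: linear_sum[OF linear_coord] linear_scale[OF linear_coord])
  also have "\<dots> = (\<Sum>a\<in>A. if a = e then c e else 0)"
    using coord_arc_vec[OF T e] A by (intro sum.cong) auto
  finally show ?thesis by (simp add: sum.delta)
qed

lemma independent_arc_vec:
  assumes T: "oriented_tree (T :: ('v::finite) rel)"
  shows "independent (arc_vec ` T)"
proof (rule independent_if_scalars_zero)
  fix f :: "real ^ 'v \<Rightarrow> real" and x
  assume z: "(\<Sum>x\<in>arc_vec ` T. f x *\<^sub>R x) = 0" and "x \<in> arc_vec ` T"
  then obtain e where e: "e \<in> T" "x = arc_vec e" by auto
  have "(\<Sum>a\<in>T. f (arc_vec a) *\<^sub>R arc_vec a) = 0"
    using z by (simp add: sum.reindex[OF inj_on_arc_vec[OF T]])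
  then show "f x = 0"
    using sum_coord[OF T order_refl e(1), of "\<lambda>a. f (arc_vec a)"] e
      linear_0[OF linear_coord, of T e] by simp
qed simp

lemma affine_independent_arc_vec:
  assumes "oriented_tree (T :: ('v::finite) rel)" "A \<subseteq> T"
  shows "\<not> affine_dependent (arc_vec ` A)"
  using independent_arc_vec[OF assms(1)] affine_dependent_subset[of "arc_vec ` A" "arc_vec ` T"]
    affine_dependent_imp_dependent assms(2) by (meson image_mono)

lemma dim_balanced: "dim {x :: real ^ 'v::finite. set_sum UNIV x = 0} = CARD('v) - 1"
proof -
  have "{x :: real ^ 'v. set_sum UNIV x = 0} = {x. 1 \<bullet> x = 0}"
    by (auto simp: set_sum_def inner_vec_def)
  then show ?thesis using dim_hyperplane[of "1 :: real ^ 'v"] by simp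
qed

lemma card_oriented_tree:
  assumes "oriented_tree (T :: ('v::finite) rel)"
  shows "card T = CARD('v) - 1"
proof -
  let ?B = "{x :: real ^ 'v. set_sum UNIV x = 0}"
  have "card T = card (arc_vec ` T :: (real ^ 'v) set)"
    using inj_on_arc_vec[OF assms] by (simp add: card_image)
  also have "\<dots> = dim ?B"
    using assms
    by (intro basis_card_eq_dim independent_arc_vec)
      (auto simp: balanced_arc_vec oriented_tree_def intro: balanced_in_span)
  finally show ?thesis by (simp add: dim_balanced)
qed

text \<open>If the ends of an arc stayed connected after its deletion, the remaining arc vectors
  would still span the hyperplane of balanced vectors, although they are fewer than its
  dimension.\<close>

lemma connected_card_imp_oriented_tree:
  assumes H: "connected_spanning (H :: ('v::finite) rel)" and c: "card H \<le> CARD('v) - 1"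
  shows "oriented_tree H"
  unfolding oriented_tree_def
proof (intro conjI H ballI)
  fix e assume e: "e \<in> H"
  obtain u v where uv: "e = (u, v)" by force
  show "fst e \<notin> head_side H e"
  proof
    assume "fst e \<in> head_side H e"
    then have "(v, u) \<in> ((H - {e}) \<union> (H - {e})\<inverse>)\<^sup>*" by (simp add: uv head_side_def)
    from rtrancl_arc_span[OF this] have "arc_vec (v, u) \<in> span (arc_vec ` (H - {e}))" .
    from span_neg[OF this] have 1: "arc_vec e \<in> span (arc_vec ` (H - {e}))"
      by (simp add: uv arc_vec_def)
    have "{x :: real ^ 'v. set_sum UNIV x = 0} \<subseteq> span (arc_vec ` (H - {e}))"
    proof
      fix x :: "real ^ 'v" assume "x \<in> {x. set_sum UNIV x = 0}"
      then have "x \<in> span (arc_vec ` H)" using balanced_in_span[OF H] by simp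
      also have "arc_vec ` H = insert (arc_vec e) (arc_vec ` (H - {e}))" using e by auto
      finally show "x \<in> span (arc_vec ` (H - {e}))" using 1 span_redundant by metis
    qed
    then have "dim {x :: real ^ 'v. set_sum UNIV x = 0} \<le> card (arc_vec ` (H - {e}) :: (real ^ 'v) set)"
      by (intro dim_le_card) auto
    also have "\<dots> \<le> card (H - {e})" by (rule card_image_le) simp
    also have "\<dots> < card H" using e by (intro card_Diff1_less) auto
    finally show False using c by (simp add: dim_balanced)
  qed
qed

section \<open>Barycentric coordinates as cut sums\<close>

lemma balanced_arc_sum: "set_sum UNIV (\<Sum>e\<in>A. c e *\<^sub>R arc_vec e) = 0"
  by (simp add: linear_sum[OF linear_set_sum] linear_scale[OF linear_set_sum] balanced_arc_vec)

lemma sum_coord_arc_sum: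
  assumes "oriented_tree T" "A \<subseteq> T"
  shows "(\<Sum>e\<in>T. coord T e (\<Sum>a\<in>A. c a *\<^sub>R arc_vec a)) = sum c A"
proof -
  have "(\<Sum>e\<in>T. coord T e (\<Sum>a\<in>A. c a *\<^sub>R arc_vec a)) = (\<Sum>e\<in>T. if e \<in> A then c e else 0)"
    using sum_coord[OF assms] by (intro sum.cong) auto
  then show ?thesis using assms(2) by (simp add: sum.If_cases Int_absorb1)
qed

text \<open>Serves the simplex and its relative interior at once: \<open>P\<close> is nonnegativity
  for the former and positivity for the latter. Taking \<open>A\<close> smaller than
  \<open>T\<close> gives the faces.\<close>

lemma image_arc_sum:
  assumes "oriented_tree T" "A \<subseteq> T"
  shows "{y. \<exists>u. (\<forall>x\<in>arc_vec ` A. P (u x)) \<and> sum u (arc_vec ` A) = 1 \<and>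
            (\<Sum>x\<in>arc_vec ` A. u x *\<^sub>R x) = y}
    = {x. set_sum UNIV x = 0 \<and> (\<forall>e\<in>A. P (coord T e x)) \<and> (\<forall>e\<in>T - A. coord T e x = 0)
        \<and> (\<Sum>e\<in>T. coord T e x) = 1}" (is "?L = ?R")
proof
  have inj: "inj_on arc_vec A" using inj_on_arc_vec[OF assms(1)] assms(2) by (rule inj_on_subset)
  show "?L \<subseteq> ?R"
  proof
    fix y assume "y \<in> ?L"
    then obtain u where u: "\<forall>a\<in>A. P (u (arc_vec a))" "(\<Sum>a\<in>A. u (arc_vec a)) = 1"
      "y = (\<Sum>a\<in>A. u (arc_vec a) *\<^sub>R arc_vec a)" by (auto simp: sum.reindex[OF inj])
    have c: "coord T e y = (if e \<in> A then u (arc_vec e) else 0)" if "e \<in> T" for e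
      unfolding u(3) using sum_coord[OF assms that, of "\<lambda>a. u (arc_vec a)"] .
    have "(\<Sum>e\<in>T. coord T e y) = 1"
      using sum_coord_arc_sum[OF assms, of "\<lambda>a. u (arc_vec a)"] u(2) unfolding u(3) by simp
    moreover have "set_sum UNIV y = 0" unfolding u(3) by (rule balanced_arc_sum)
    ultimately show "y \<in> ?R" using c u(1) assms(2) by auto
  qed
  show "?R \<subseteq> ?L"
  proof
    fix y assume y: "y \<in> ?R"
    define u where "u x = coord T (inv_into A arc_vec x) y" for x
    have u: "u (arc_vec a) = coord T a y" if "a \<in> A" for a
      using that by (simp add: u_def inj)
    have "sum u (arc_vec ` A) = (\<Sum>a\<in>A. coord T a y)"
      by (simp add: sum.reindex[OF inj] u)
    also have "\<dots> = (\<Sum>a\<in>T. coord T a y)"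
      using y assms(2) by (intro sum.mono_neutral_left) auto
    finally have "sum u (arc_vec ` A) = 1" using y by simp
    moreover have "(\<Sum>x\<in>arc_vec ` A. u x *\<^sub>R x) = y"
    proof -
      have "(\<Sum>x\<in>arc_vec ` A. u x *\<^sub>R x) = (\<Sum>a\<in>A. coord T a y *\<^sub>R arc_vec a)"
        by (simp add: sum.reindex[OF inj] u)
      also have "\<dots> = (\<Sum>a\<in>T. coord T a y *\<^sub>R arc_vec a)"
        using y assms(2) by (intro sum.mono_neutral_left) auto
      also have "\<dots> = y" using tree_expansion[OF assms(1)] y by auto
      finally show ?thesis .
    qed
    moreover have "\<forall>x\<in>arc_vec ` A. P (u x)" using y u by auto
    ultimately show "y \<in> ?L" by blast
  qed
qed

lemma in_arc_polytope_iff: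
  fixes x :: "real ^ 'v::finite"
  assumes "oriented_tree T" "A \<subseteq> T"
  shows "x \<in> arc_polytope A \<longleftrightarrow> set_sum UNIV x = 0 \<and> (\<forall>e\<in>A. 0 \<le> coord T e x)
     \<and> (\<forall>e\<in>T - A. coord T e x = 0) \<and> (\<Sum>e\<in>T. coord T e x) = 1"
proof -
  have "finite (arc_vec ` A :: (real ^ 'v) set)" by simp
  then have "arc_polytope A = {y. \<exists>u. (\<forall>x\<in>arc_vec ` A. 0 \<le> u x) \<and> sum u (arc_vec ` A) = 1 \<and>
            (\<Sum>x\<in>arc_vec ` A. u x *\<^sub>R x) = (y :: real ^ 'v)}"
    unfolding arc_polytope_eq by (rule convex_hull_finite)
  then show ?thesis unfolding image_arc_sum[OF assms, of "\<lambda>r. 0 \<le> r"] by simp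
qed

lemma in_rel_interior_arc_polytope_iff:
  fixes x :: "real ^ 'v::finite"
  assumes "oriented_tree T" "A \<subseteq> T"
  shows "x \<in> rel_interior (arc_polytope A) \<longleftrightarrow> set_sum UNIV x = 0 \<and> (\<forall>e\<in>A. 0 < coord T e x)
     \<and> (\<forall>e\<in>T - A. coord T e x = 0) \<and> (\<Sum>e\<in>T. coord T e x) = 1"
proof -
  have "rel_interior (arc_polytope A) =
    {y. \<exists>u. (\<forall>x\<in>arc_vec ` A. 0 < u x) \<and> sum u (arc_vec ` A) = 1 \<and>
            (\<Sum>x\<in>arc_vec ` A. u x *\<^sub>R x) = (y :: real ^ 'v)}"
    unfolding arc_polytope_eq
    by (rule rel_interior_convex_hull_explicit[OF affine_independent_arc_vec[OF assms]])
  then show ?thesis unfolding image_arc_sum[OF assms, of "\<lambda>r. 0 < r"] by simp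
qed

section \<open>Undirected cycles against fundamental cuts\<close>

text \<open>A shortest walk from \<open>v\<close> back to \<open>u\<close> that avoids the arc
  repeats no vertex, so the arc closes it to a cycle.\<close>

lemma head_side_walk_imp_cycle:
  assumes e: "(u, v) \<in> T" and anti: "T \<inter> T\<inverse> = {}" and u: "u \<in> head_side T (u, v)"
  shows "\<exists>xs. undirected_cycle T xs"
proof -
  define R where "R = (T - {(u, v)}) \<union> (T - {(u, v)})\<inverse>"
  have "(v, u) \<in> R\<^sup>*" using u by (simp add: head_side_def R_def)
  then obtain n0 where "(v, u) \<in> R ^^ n0" using rtrancl_imp_relpow by blast
  define n where "n = (LEAST n. (v, u) \<in> R ^^ n)"
  have n: "(v, u) \<in> R ^^ n" unfolding n_def by (rule LeastI) fact
  have least: "(v, u) \<notin> R ^^ m" if "m < n" for m using that not_less_Least unfolding n_def by blast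
  obtain f where f: "f 0 = v" "f n = u" "\<And>i. i < n \<Longrightarrow> (f i, f (Suc i)) \<in> R"
    using n unfolding relpow_fun_conv by blast
  have walk: "i \<le> j \<Longrightarrow> j \<le> n \<Longrightarrow> (f i, f j) \<in> R ^^ (j - i)" for i j
    unfolding relpow_fun_conv by (intro exI[of _ "\<lambda>k. f (i + k)"]) (auto intro: f(3))
  \<comment> \<open>Cutting out the loop between two visits of a vertex would shorten the
    walk.\<close>
  have ne: "f i \<noteq> f j" if "i < j" "j \<le> n" for i j
  proof
    assume eq: "f i = f j"
    have "(v, f i) \<in> R ^^ i" "(f j, u) \<in> R ^^ (n - j)" using walk[of 0 i] walk[of j n] that f by auto
    then have "(v, u) \<in> R ^^ (i + (n - j))" unfolding relpow_add using eq by auto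
    then show False using least[of "i + (n - j)"] that by fastforce
  qed
  have "inj_on f {0..<Suc n}"
    by (rule inj_onI) (metis ne atLeastLessThan_iff less_Suc_eq_le linorder_neqE_nat)
  moreover have "2 \<le> n"
  proof -
    have "n \<noteq> 0" using f e anti by auto
    moreover have "n \<noteq> 1" using f(1,2) f(3)[of 0] e anti by (auto simp: R_def)
    ultimately show ?thesis by linarith
  qed
  moreover have "(f i, f (Suc i mod Suc n)) \<in> T \<union> T\<inverse>" if "i < Suc n" for i
  proof (cases "i = n")
    case True
    then show ?thesis using f e by simp
  next
    case False
    then have "i < n" using that by simp
    then show ?thesis using f(3)[of i] by (auto simp: R_def)
  qed
  ultimately have "undirected_cycle T (map f [0..<Suc n])"
    unfolding undirected_cycle_def by (auto simp: distinct_map nth_append simp del: upt_Suc)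
  then show ?thesis by blast
qed

lemma sym_rtrancl_sym: "(a, b) \<in> (R \<union> R\<inverse>)\<^sup>* \<Longrightarrow> (b, a) \<in> (R \<union> R\<inverse>)\<^sup>*"
  by (metis converse_Un converse_converse rtrancl_converseI sup_commute)

text \<open>After deletion of the first edge of the cycle, the rest of the cycle still joins its
  ends. Either orientation of that edge may be the one in \<open>T\<close>.\<close>

lemma cycle_imp_head_side_walk:
  assumes "undirected_cycle T xs"
  shows "\<exists>e\<in>T. fst e \<in> head_side T e"
proof -
  let ?n = "length xs"
  have n: "3 \<le> ?n" "distinct xs" and
    step: "\<And>i. i < ?n \<Longrightarrow> (xs ! i, xs ! (Suc i mod ?n)) \<in> T \<union> T\<inverse>"
    using assms by (auto simp: undirected_cycle_def)
  have len: "1 < ?n" "0 < ?n" using n(1) by linarith+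
  define a b where "a = xs ! 0" and "b = xs ! 1"
  have "Suc 0 mod ?n = 1" using len by simp
  then have ab: "(a, b) \<in> T \<union> T\<inverse>" using step[OF len(2)] by (simp add: a_def b_def)
  have main: "(b, a) \<in> ((T - {e}) \<union> (T - {e})\<inverse>)\<^sup>*" if e: "e = (a, b) \<or> e = (b, a)" for e
  proof -
    let ?R = "(T - {e}) \<union> (T - {e})\<inverse>"
    have R: "(xs ! i, xs ! (Suc i mod ?n)) \<in> ?R" if i: "0 < i" "i < ?n" for i
    proof -
      have "xs ! i \<noteq> a" using nth_eq_iff_index_eq[OF n(2) i(2) len(2)] i by (simp add: a_def)
      \<comment> \<open>The deleted edge could reappear only as a step from \<open>b\<close>
        straight back to \<open>a\<close>, which would make the cycle have length 2.\<close>
      moreover have "\<not> (xs ! i = b \<and> xs ! (Suc i mod ?n) = a)"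
      proof
        assume *: "xs ! i = b \<and> xs ! (Suc i mod ?n) = a"
        have next_len: "Suc i mod ?n < ?n" using len(2) by simp
        have "i = 1" "Suc i mod ?n = 0"
          using * nth_eq_iff_index_eq[OF n(2) i(2) len(1)] nth_eq_iff_index_eq[OF n(2) next_len len(2)]
          by (auto simp: a_def b_def)
        then show False using n by simp
      qed
      ultimately show ?thesis using step[OF i(2)] e by auto
    qed
    have "(b, xs ! Suc i) \<in> ?R\<^sup>*" if "Suc i < ?n" for i
      using that
    proof (induction i)
      case 0
      then show ?case by (simp add: b_def)
    next
      case (Suc i)
      then have "(xs ! Suc i, xs ! Suc (Suc i)) \<in> ?R" using R[of "Suc i"] by simp
      then show ?case using Suc by (meson Suc_lessD rtrancl.rtrancl_into_rtrancl)
    qed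
    from this[of "?n - 2"] have "(b, xs ! (?n - 1)) \<in> ?R\<^sup>*" using n
      by (simp add: Suc_diff_Suc numeral_2_eq_2)
    moreover have "(xs ! (?n - 1), a) \<in> ?R"
    proof -
      have "0 < ?n - 1" "?n - 1 < ?n" "Suc (?n - 1) mod ?n = 0" using len by simp_all
      then show ?thesis using R[of "?n - 1"] by (simp add: a_def)
    qed
    ultimately show ?thesis by (rule rtrancl_into_rtrancl)
  qed
  show ?thesis
  proof (cases "(a, b) \<in> T")
    case True
    then show ?thesis using main[of "(a, b)"] by (force simp: head_side_def)
  next
    case False
    then have "(b, a) \<in> T" using ab by auto
    then show ?thesis using sym_rtrancl_sym[OF main[of "(b, a)"]] by (force simp: head_side_def)
  qed
qed

lemma spanning_tree_iff:
  assumes "G \<inter> G\<inverse> = {}"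
  shows "spanning_tree T G \<longleftrightarrow> T \<subseteq> G \<and> oriented_tree T"
proof -
  have "(\<nexists>xs. undirected_cycle T xs) \<longleftrightarrow> (\<forall>e\<in>T. fst e \<notin> head_side T e)" if "T \<subseteq> G"
  proof -
    have "T \<inter> T\<inverse> = {}" using that assms by blast
    then show ?thesis
      using cycle_imp_head_side_walk[of T] head_side_walk_imp_cycle[of _ _ T] by fastforce
  qed
  then show ?thesis unfolding spanning_tree_def oriented_tree_def by blast
qed

subsection \<open>Tight faces and spanning trees\<close>

lemma linear_le_imp_convex:
  assumes "linear (f :: 'a::real_vector \<Rightarrow> real)"
  shows "convex {x. f x \<le> c}"
  by (rule convexI)
    (simp add: linear_add[OF assms] linear_scale[OF assms] convex_bound_le)

lemma linear_eq_imp_affine: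
  assumes "linear (f :: 'a::real_vector \<Rightarrow> real)"
  shows "affine {x. f x = c}"
  unfolding affine_def
  by (simp add: linear_add[OF assms] linear_scale[OF assms] flip: distrib_right)

text \<open>An average of numbers that are at most \<open>c\<close> equals \<open>c\<close> only if
  all the weight lies on those equal to \<open>c\<close>.\<close>

lemma convex_hull_tight:
  fixes f :: "'a::real_vector \<Rightarrow> real"
  assumes S: "finite S" and f: "linear f" "\<And>y. y \<in> S \<Longrightarrow> f y \<le> c"
    and x: "x \<in> convex hull S" "f x = c"
  shows "x \<in> convex hull {y \<in> S. f y = c}"
proof -
  obtain u where u: "\<And>y. y \<in> S \<Longrightarrow> 0 \<le> u y" "sum u S = 1" "(\<Sum>y\<in>S. u y *\<^sub>R y) = x"
    using x(1) unfolding convex_hull_finite[OF S] by blast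
  have "(\<Sum>y\<in>S. u y * f y) = f (\<Sum>y\<in>S. u y *\<^sub>R y)"
    by (simp add: linear_sum[OF f(1)] linear_scale[OF f(1)])
  then have fx: "(\<Sum>y\<in>S. u y * f y) = c" using u(3) x(2) by simp
  have "(\<Sum>y\<in>S. u y * (c - f y)) = (\<Sum>y\<in>S. u y) * c - (\<Sum>y\<in>S. u y * f y)"
    by (simp add: right_diff_distrib sum_subtractf sum_distrib_right)
  then have sum0: "(\<Sum>y\<in>S. u y * (c - f y)) = 0" using u(2) fx by simp
  have "u y * (c - f y) = 0" if "y \<in> S" for y
  proof -
    have "\<forall>y\<in>S. 0 \<le> u y * (c - f y)" using u(1) f(2) by simp
    then show ?thesis using sum0 that sum_nonneg_eq_0_iff[OF S, of "\<lambda>y. u y * (c - f y)"] by blast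
  qed
  then have zero: "u y = 0" if "y \<in> S - {y \<in> S. f y = c}" for y using that by force
  have "sum u {y \<in> S. f y = c} = 1"
    using u(2) zero S sum.mono_neutral_left[of S "{y \<in> S. f y = c}" u] by auto
  moreover have "(\<Sum>y\<in>{y \<in> S. f y = c}. u y *\<^sub>R y) = x"
    using u(3) zero S sum.mono_neutral_left[of S "{y \<in> S. f y = c}" "\<lambda>y. u y *\<^sub>R y"] by auto
  moreover have "(\<Sum>y\<in>{y \<in> S. f y = c}. u y *\<^sub>R y) \<in> convex hull {y \<in> S. f y = c}"
    using calculation(1) u(1) S by (intro convex_sum) (auto intro: hull_inc)
  ultimately show ?thesis by simp
qed

text \<open>A subset of least cardinality is affinely independent by Caratheodory. It lies in the
  hyperplane \<open>f = 1\<close>, which misses the origin, and so it is even linearly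
  independent.\<close>

lemma caratheodory_independent:
  fixes f :: "'a::euclidean_space \<Rightarrow> real"
  assumes S: "finite S" and f: "linear f" "\<And>y. y \<in> S \<Longrightarrow> f y = 1" and x: "x \<in> convex hull S"
  obtains B where "B \<subseteq> S" "independent B" "x \<in> convex hull B"
proof -
  define P where "P n \<longleftrightarrow> (\<exists>B\<subseteq>S. card B = n \<and> x \<in> convex hull B)" for n
  have "P (card S)" using x by (auto simp: P_def)
  then obtain n where n: "P n" "\<And>m. m < n \<Longrightarrow> \<not> P m" using exists_least_iff[of P] by blast
  then obtain B where B: "B \<subseteq> S" "card B = n" "x \<in> convex hull B" by (auto simp: P_def)
  have finB: "finite B" using B(1) S by (rule finite_subset)
  have "\<not> affine_dependent B"
  proof
    assume "affine_dependent B"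
    then have "aff_dim B + 1 < int (card B)"
      using affine_independent_iff_card[of B] aff_dim_le_card[OF finB] finB by simp
    moreover obtain C where "C \<subseteq> B" "int (card C) \<le> aff_dim B + 1" "x \<in> convex hull C"
      using B(3) unfolding caratheodory_aff_dim[of B] by blast
    ultimately show False using n(2)[of "card C"] B by (auto simp: P_def)
  qed
  moreover have "0 \<notin> affine hull B"
  proof -
    have "affine hull B \<subseteq> {y. f y = 1}"
      using B(1) f by (intro hull_minimal linear_eq_imp_affine) auto
    then show ?thesis using linear_0[OF f(1)] by auto
  qed
  ultimately have "\<not> affine_dependent (insert 0 B)" "0 \<notin> B"
    using affine_independent_insert[where S=B and a=0] hull_inc[of 0 B] by auto
  then have "independent B" using dependent_imp_affine_dependent[where S=B and a=0] by auto
  then show thesis using that B by blast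
qed

text \<open>Summation over a component of \<open>T\<close> kills every arc vector of
  \<open>T\<close>, hence every arc vector of \<open>H\<close>. So no arc of \<open>H\<close> leaves
  the component.\<close>

lemma span_imp_connected:
  assumes "connected_spanning H" "arc_vec ` H \<subseteq> span (arc_vec ` T)"
  shows "connected_spanning (T :: ('v::finite) rel)"
  unfolding connected_spanning_def
proof (intro allI)
  fix a b
  define C where "C = (T \<union> T\<inverse>)\<^sup>* `` {a}"
  have T: "u \<in> C \<longleftrightarrow> v \<in> C" if "(u, v) \<in> T" for u v
    using that unfolding C_def by (auto intro: rtrancl_into_rtrancl)
  have "set_sum C y = 0" if "y \<in> span (arc_vec ` T)" for y
    using that
  proof (induction rule: span_induct)
    case base
    show ?case
      by (simp add: subspace_def linear_0[OF linear_set_sum] linear_add[OF linear_set_sum]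
          linear_scale[OF linear_set_sum])
  next
    case (step y)
    then show ?case using T by (auto simp: set_sum_arc_vec)
  qed
  then have zero: "set_sum C (arc_vec e) = 0" if "e \<in> H" for e using assms(2) that by blast
  have H: "u \<in> C \<longleftrightarrow> v \<in> C" if "(u, v) \<in> H" for u v
    using zero[OF that] by (auto simp: set_sum_arc_vec split: if_splits)
  have "(a, b) \<in> (H \<union> H\<inverse>)\<^sup>*" using assms(1) by (simp add: connected_spanning_def)
  then have "b \<in> C"
  proof (induction rule: rtrancl_induct)
    case base
    then show ?case by (simp add: C_def)
  next
    case (step y z)
    then show ?case using H[of y z] H[of z y] by auto
  qed
  then show "(a, b) \<in> (T \<union> T\<inverse>)\<^sup>*" by (simp add: C_def)
qed

lemma inj_on_arc_vec_loopless:
  assumes "\<And>v. (v, v) \<notin> A"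
  shows "inj_on arc_vec A"
proof (rule inj_onI)
  fix e e' assume e: "e \<in> A" "e' \<in> A" "arc_vec e = arc_vec e'"
  obtain a b c d where abcd: "e = (a, b)" "e' = (c, d)" by force
  have "set_sum {w} (arc_vec e) = set_sum {w} (arc_vec e')" for w using e by simp
  note eq = this[of b] this[of a]
  have "a \<noteq> b" using e abcd assms by auto
  then show "e = e'" using eq unfolding abcd set_sum_arc_vec by (auto simp: of_bool_def split: if_splits)
qed

text \<open>A maximal independent set of arc vectors containing \<open>B\<close> spans the others,
  which gives connectedness; its independence bounds the number of arcs.\<close>

lemma extend_to_oriented_tree:
  fixes A :: "('v::finite) rel"
  assumes A: "connected_spanning A" "\<And>v. (v, v) \<notin> A" and B: "B \<subseteq> arc_vec ` A" "independent B"
  obtains T where "T \<subseteq> A" "oriented_tree T" "B \<subseteq> arc_vec ` T"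
proof -
  obtain C where C: "B \<subseteq> C" "C \<subseteq> arc_vec ` A" "independent C" "arc_vec ` A \<subseteq> span C"
    using maximal_independent_subset_extend[OF B] .
  define T where "T = {e \<in> A. arc_vec e \<in> C}"
  have T: "arc_vec ` T = C" "T \<subseteq> A" using C(2) by (auto simp: T_def)
  have "card T = card C"
    using card_image[OF inj_on_subset[OF inj_on_arc_vec_loopless[OF A(2)] T(2)]] T(1) by simp
  also have "\<dots> \<le> dim {x :: real ^ 'v. set_sum UNIV x = 0}"
    using C(2,3) by (intro independent_card_le_dim) (auto simp: balanced_arc_vec dest!: subsetD[OF C(2)])
  finally have "card T \<le> CARD('v) - 1" by (simp add: dim_balanced)
  moreover have "connected_spanning T" using span_imp_connected[OF A(1)] C(4) T(1) by simp
  ultimately show thesis using that[of T] T C(1) connected_card_imp_oriented_tree by blast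
qed

text \<open>
  A function whose tight arcs are not yet connected can be raised on the complement of the
  component of \<open>r\<close> until a further arc becomes tight.
\<close>
lemma grow_tight_component:
  fixes a :: "'v::finite \<Rightarrow> real"
  assumes E: "connected_spanning E" "sym E" and a: "\<And>u v. (u, v) \<in> E \<Longrightarrow> a v - a u \<le> 1"
    and C: "C = ({(u, v) \<in> E. a v - a u = 1} \<union> {(u, v) \<in> E. a v - a u = 1}\<inverse>)\<^sup>* `` {r}" "C \<noteq> UNIV"
  obtains d where "0 < d" "\<And>u v. (u, v) \<in> E \<Longrightarrow> (a v + d * of_bool (v \<notin> C)) - (a u + d * of_bool (u \<notin> C)) \<le> 1"
    "\<exists>u v. (u, v) \<in> E \<and> u \<in> C \<and> v \<notin> C \<and> (a v + d * of_bool (v \<notin> C)) - (a u + d * of_bool (u \<notin> C)) = 1"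
proof -
  \<comment> \<open>The slacks of the edges leaving \<open>C\<close>. All are positive, as a tight
    edge would not leave the component; the smallest is the amount of the lift.\<close>
  define M where "M = (\<lambda>(u, v). 1 - (a v - a u)) ` (E \<inter> C \<times> (- C))"
  have "r \<in> C" using C(1) by simp
  obtain w where w: "w \<notin> C" using C(2) by auto
  have "(r, w) \<in> (E \<union> E\<inverse>)\<^sup>*" using E by (simp add: connected_spanning_def)
  then have "E \<inter> C \<times> (- C) \<noteq> {}"
    using w
  proof (induction rule: rtrancl_induct)
    case base
    then show ?case using \<open>r \<in> C\<close> by simp
  next
    case (step y z)
    have "(y, z) \<in> E" using step(2) E(2) by (auto dest: symD)
    then show ?case using step by (cases "y \<in> C") auto
  qed
  then have M: "finite M" "M \<noteq> {}" by (auto simp: M_def)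
  have "m > 0" if m: "m \<in> M" for m
  proof -
    obtain u v where uv: "m = 1 - (a v - a u)" "(u, v) \<in> E" "u \<in> C" "v \<notin> C" using m by (auto simp: M_def)
    have "a v - a u \<noteq> 1" using uv unfolding C(1) by (auto intro: rtrancl_into_rtrancl)
    then show ?thesis using a[OF uv(2)] uv(1) by simp
  qed
  then have pos: "0 < Min M" using M by simp
  show thesis
  proof (rule that[OF pos])
    fix u v assume uv: "(u, v) \<in> E"
    have "Min M \<le> 1 - (a v - a u)" if "u \<in> C" "v \<notin> C"
      using that uv M by (intro Min_le) (auto simp: M_def)
    then show "(a v + Min M * of_bool (v \<notin> C)) - (a u + Min M * of_bool (u \<notin> C)) \<le> 1"
      using a[OF uv] pos by (cases "u \<in> C"; cases "v \<in> C") auto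
  next
    define m where "m = Min M"
    have "m \<in> M" unfolding m_def using M by (rule Min_in)
    then obtain u v where "(u, v) \<in> E" "u \<in> C" "v \<notin> C" "m = 1 - (a v - a u)"
      unfolding M_def by auto
    then have uv: "(u, v) \<in> E" "u \<in> C" "v \<notin> C" "Min M = 1 - (a v - a u)"
      by (simp_all add: m_def)
    then have "(a v + Min M * of_bool (v \<notin> C)) - (a u + Min M * of_bool (u \<notin> C)) = 1" by simp
    then show "\<exists>u v. (u, v) \<in> E \<and> u \<in> C \<and> v \<notin> C \<and>
      (a v + Min M * of_bool (v \<notin> C)) - (a u + Min M * of_bool (u \<notin> C)) = 1"
      using uv by blast
  qed
qed

section \<open>Listing a finite set in a strict linear order\<close>

lemma finite_strict_linear_order_sorted_list:
  assumes "finite A" "strict_linear_order_on A r"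
  shows "\<exists>xs. distinct xs \<and> set xs = A \<and> sorted_wrt (\<lambda>p q. (p, q) \<in> r) xs"
  using assms
proof (induction "card A" arbitrary: A)
  case 0
  then show ?case by simp
next
  case (Suc n)
  have r: "trans r" "irrefl r" "total_on A r" using Suc.prems(2) by (auto simp: strict_linear_order_on_def)
  have ne: "A \<noteq> {}" using Suc.hyps(2) by auto
  have trans: "transp_on A (\<lambda>p q. (p, q) \<in> r)"
    by (rule transp_onI) (rule transD[OF r(1)])
  have asym: "asymp_on A (\<lambda>p q. (p, q) \<in> r)"
    by (rule asymp_onI) (use transD[OF r(1)] r(2) in \<open>unfold irrefl_def, blast\<close>)
  from Finite_Set.bex_min_element[OF Suc.prems(1) asym trans ne]
  obtain m where m: "m \<in> A" "\<forall>x\<in>A. x \<noteq> m \<longrightarrow> (x, m) \<notin> r"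
    by (rule bexE)
  have "n = card (A - {m})" "finite (A - {m})" using Suc.hyps(2) Suc.prems(1) m(1) by simp_all
  moreover have "strict_linear_order_on (A - {m}) r"
    using r unfolding strict_linear_order_on_def total_on_def by blast
  ultimately obtain ys where ys: "distinct ys" "set ys = A - {m}" "sorted_wrt (\<lambda>p q. (p, q) \<in> r) ys"
    using Suc.hyps(1) by blast
  have "(m, y) \<in> r" if "y \<in> set ys" for y
    using that ys(2) m r(3) unfolding total_on_def by (metis Diff_iff insertI1)
  then show ?case using ys m(1) by (intro exI[of _ "m # ys"]) auto
qed

subsection \<open>Tours\<close>

locale ribbon_graph =
  fixes E :: "('v::finite) rel" and rot :: "'v \<Rightarrow> 'v \<Rightarrow> 'v" and b0 b1 :: 'v
  assumes simple: "simple_graph E"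
    and connected: "connected_spanning E"
    and ribbon: "ribbon_structure E rot"
    and base: "(b0, b1) \<in> E"
begin

lemma E_sym: "(x, y) \<in> E \<Longrightarrow> (y, x) \<in> E"
  using simple by (auto simp: simple_graph_def sym_def)

lemma E_irrefl: "(x, x) \<notin> E"
  using simple by (auto simp: simple_graph_def irrefl_def)

lemma rot_cyclic: "(x, y) \<in> E \<Longrightarrow> cyclic_on (rot x) (E `` {x})"
  using ribbon by (auto simp: ribbon_structure_def)

lemma rot_in:
  assumes "(x, y) \<in> E"
  shows "(x, rot x y) \<in> E"
proof -
  have "E `` {x} = orbit (rot x) y"
    using rot_cyclic[OF assms] assms by (auto simp: cyclic_on_alldef)
  then show ?thesis using orbit.base[of "rot x" y] by auto
qed

text \<open>Each neighbour lies in its own orbit and is therefore an image; a surjection of a finite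
  set onto itself is injective.\<close>

lemma rot_inj:
  assumes "(x, y) \<in> E" "(x, z) \<in> E" "rot x y = rot x z"
  shows "y = z"
proof -
  let ?S = "E `` {x}"
  have orb: "?S = orbit (rot x) s" if "s \<in> ?S" for s
    using rot_cyclic[OF assms(1)] that by (auto simp: cyclic_on_alldef)
  have "s \<in> rot x ` ?S" if "s \<in> ?S" for s
  proof -
    have "s \<in> orbit (rot x) s" using orb[OF that] that by simp
    then show ?thesis
    proof cases
      case base
      then show ?thesis using that by (metis imageI)
    next
      case (step t)
      then show ?thesis using orb[OF that] by (metis imageI)
    qed
  qed
  moreover have "rot x ` ?S \<subseteq> ?S" using rot_in by auto
  ultimately have "rot x ` ?S = ?S" by auto
  then have "inj_on (rot x) ?S" by (intro eq_card_imp_inj_on) auto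
  then show ?thesis using assms by (auto dest: inj_onD)
qed

text \<open>The tour continued periodically forever; the list \<open>tour\<close> is its first
  period. This allows arguments that wrap around the base.\<close>

definition tour_at :: "'v rel \<Rightarrow> nat \<Rightarrow> 'v \<times> 'v" where
  "tour_at T k = (tour_step rot T ^^ k) (b0, b1)"

lemma tour_at_0: "tour_at T 0 = (b0, b1)"
  by (simp add: tour_at_def)

lemma tour_at_Suc: "tour_at T (Suc k) = tour_step rot T (tour_at T k)"
  by (simp add: tour_at_def)

lemma tour_step_in: "T \<subseteq> E \<Longrightarrow> e \<in> E \<Longrightarrow> tour_step rot T e \<in> E"
  by (cases e) (auto simp: tour_step_def rot_in E_sym)

text \<open>The edge preceding the new one at the new node is the edge just treated. Whether it
  belongs to \<open>T\<close> tells from which end it was reached.\<close>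

lemma tour_step_inj:
  assumes T: "T \<subseteq> E"
  shows "inj_on (tour_step rot T) E"
proof (rule inj_onI)
  fix e e' assume *: "e \<in> E" "e' \<in> E" "tour_step rot T e = tour_step rot T e'"
  obtain x y x' y' where e: "e = (x, y)" "e' = (x', y')" by force
  show "e = e'"
  proof (cases "(x, y) \<in> T \<union> T\<inverse>"; cases "(x', y') \<in> T \<union> T\<inverse>")
    assume "(x, y) \<in> T \<union> T\<inverse>" "(x', y') \<in> T \<union> T\<inverse>"
    then have "y = y'" "rot y x = rot y x'" using *(3) by (auto simp: e tour_step_def)
    then show ?thesis using rot_inj[of y x x'] * E_sym by (auto simp: e)
  next
    assume c: "(x, y) \<in> T \<union> T\<inverse>" "(x', y') \<notin> T \<union> T\<inverse>"
    then have "y = x'" "rot y x = rot y y'" using *(3) by (auto simp: e tour_step_def)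
    then show ?thesis using rot_inj[of y x y'] * E_sym c by (auto simp: e)
  next
    assume c: "(x, y) \<notin> T \<union> T\<inverse>" "(x', y') \<in> T \<union> T\<inverse>"
    then have "y' = x" "rot x y = rot x x'" using *(3) by (auto simp: e tour_step_def)
    then show ?thesis using rot_inj[of x y x'] * E_sym c by (auto simp: e)
  next
    assume "(x, y) \<notin> T \<union> T\<inverse>" "(x', y') \<notin> T \<union> T\<inverse>"
    then have "x = x'" "rot x y = rot x y'" using *(3) by (auto simp: e tour_step_def)
    then show ?thesis using rot_inj[of x y y'] * by (auto simp: e)
  qed
qed

lemma tour_at_in: "T \<subseteq> E \<Longrightarrow> tour_at T k \<in> E"
  by (induction k) (auto simp: tour_at_0 tour_at_Suc base tour_step_in)

text \<open>Injectivity moves a coincidence of two positions back to the start, so the tour returns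
  to its base pair.\<close>

lemma tour_at_cancel:
  assumes T: "T \<subseteq> E" and eq: "tour_at T i = tour_at T (i + d)"
  shows "tour_at T d = (b0, b1)"
  using eq
proof (induction i)
  case 0
  then show ?case by (simp add: tour_at_0)
next
  case (Suc i)
  then show ?case using tour_step_inj[OF T] tour_at_in[OF T] by (auto simp: tour_at_Suc dest: inj_onD)
qed

abbreviation period :: "'v rel \<Rightarrow> nat" where
  "period T \<equiv> tour_length rot (b0, b1) T"

lemma period_props:
  assumes T: "T \<subseteq> E"
  shows "0 < period T" "tour_at T (period T) = (b0, b1)"
    "\<And>d. 0 < d \<Longrightarrow> d < period T \<Longrightarrow> tour_at T d \<noteq> (b0, b1)"
proof -
  have "\<not> inj (tour_at T)"
    using finite_imageD[of "tour_at T" UNIV] infinite_UNIV_nat by auto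
  then obtain i j where "i < j" "tour_at T i = tour_at T j"
    unfolding inj_def by (metis linorder_neqE_nat)
  then have ex: "\<exists>n. 0 < n \<and> tour_at T n = (b0, b1)"
    using tour_at_cancel[OF T, of i "j - i"] by (intro exI[of _ "j - i"]) simp
  have len: "period T = (LEAST n. 0 < n \<and> tour_at T n = (b0, b1))"
    by (simp add: tour_length_def tour_at_def)
  show "0 < period T" "tour_at T (period T) = (b0, b1)"
    using LeastI_ex[OF ex] unfolding len by auto
  show "tour_at T d \<noteq> (b0, b1)" if "0 < d" "d < period T" for d
    using not_less_Least[of d "\<lambda>n. 0 < n \<and> tour_at T n = (b0, b1)"] that unfolding len by auto
qed

lemma tour_at_mod: "T \<subseteq> E \<Longrightarrow> tour_at T (k mod period T) = tour_at T k"
  using period_props(2) unfolding tour_at_def by (intro funpow_mod_eq) auto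

lemma tour_at_inj:
  assumes T: "T \<subseteq> E" and "i < period T" "j < period T" "tour_at T i = tour_at T j"
  shows "i = j"
proof -
  have False if "i < j" "j < period T" "tour_at T i = tour_at T j" for i j
    using tour_at_cancel[OF T, of i "j - i"] period_props(3)[OF T, of "j - i"] that by auto
  then show ?thesis using assms by (metis linorder_neqE_nat)
qed

lemma tour_nth: "length (tour rot (b0, b1) T) = period T"
  "k < period T \<Longrightarrow> tour rot (b0, b1) T ! k = tour_at T k"
  by (auto simp: tour_def tour_at_def)

lemma fst_tour_step: "fst (tour_step rot T (x, y)) = (if (x, y) \<in> T \<union> T\<inverse> then y else x)"
  by (simp add: tour_step_def)

section \<open>The tour and a fundamental cut\<close>

context
  fixes T :: "'v rel" and e u v D
  assumes tree: "oriented_tree T" and e: "e = (u, v)" "e \<in> T" and D: "D = head_side T e"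
begin

lemma step_leaves_head_side:
  assumes "(x, y) \<in> T \<union> T\<inverse>" "x \<in> D" "y \<notin> D"
  shows "(x, y) = (v, u)"
  using assms tail_notin_head_side[OF tree, of u v] head_side_crossing[of x y T e]
    head_side_crossing[of y x T e] e D by auto

lemma step_enters_head_side:
  assumes "(x, y) \<in> T \<union> T\<inverse>" "x \<notin> D" "y \<in> D"
  shows "(x, y) = (u, v)"
  using step_leaves_head_side[of y x] assms by auto

text \<open>The node changes only along tree edges, and \<open>e\<close> is the only tree edge
  across the cut. So any exit happens at the pair \<open>(v, u)\<close>.\<close>

lemma tour_leaves_head_side:
  assumes "i \<le> j" "fst (tour_at T i) \<in> D" "fst (tour_at T j) \<notin> D"
  shows "\<exists>m\<ge>i. m < j \<and> tour_at T m = (v, u)"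
  using assms
proof (induction j rule: dec_induct)
  case base
  then show ?case by simp
next
  case (step n)
  show ?case
  proof (cases "fst (tour_at T n) \<in> D")
    case True
    obtain x y where xy: "tour_at T n = (x, y)" by force
    then have "(x, y) \<in> T \<union> T\<inverse>" "x \<in> D" "y \<notin> D"
      using True step.prems fst_tour_step[of T x y] by (auto simp: tour_at_Suc split: if_splits)
    then show ?thesis using step_leaves_head_side xy step.hyps by (intro exI[of _ n]) auto
  next
    case False
    then show ?thesis using step by (metis less_SucI)
  qed
qed

lemma tour_enters_head_side:
  assumes "i \<le> j" "fst (tour_at T i) \<notin> D" "fst (tour_at T j) \<in> D"
  shows "\<exists>m\<ge>i. m < j \<and> tour_at T m = (u, v)"
  using assms
proof (induction j rule: dec_induct)
  case base
  then show ?case by simp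
next
  case (step n)
  show ?case
  proof (cases "fst (tour_at T n) \<notin> D")
    case True
    obtain x y where xy: "tour_at T n = (x, y)" by force
    then have "(x, y) \<in> T \<union> T\<inverse>" "x \<notin> D" "y \<in> D"
      using True step.prems fst_tour_step[of T x y] by (auto simp: tour_at_Suc split: if_splits)
    then show ?thesis using step_enters_head_side xy step.hyps by (intro exI[of _ n]) auto
  next
    case False
    then show ?thesis using step by (metis less_SucI)
  qed
qed

text \<open>Each entry uses the pair \<open>(u, v)\<close>, which occurs only once in a
  period.\<close>

lemma tour_no_reentry:
  assumes T: "T \<subseteq> E" and "i < j" "j < k" "k < l" "l < period T"
  shows "\<not> (fst (tour_at T i) \<notin> D \<and> fst (tour_at T j) \<in> D \<and> fst (tour_at T k) \<notin> D
    \<and> fst (tour_at T l) \<in> D)"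
proof
  assume *: "fst (tour_at T i) \<notin> D \<and> fst (tour_at T j) \<in> D \<and> fst (tour_at T k) \<notin> D
    \<and> fst (tour_at T l) \<in> D"
  obtain m where "m < j" "tour_at T m = (u, v)" using tour_enters_head_side[of i j] * assms by auto
  moreover obtain m' where "m' \<ge> k" "m' < l" "tour_at T m' = (u, v)"
    using tour_enters_head_side[of k l] * assms by auto
  ultimately show False using tour_at_inj[OF T, of m m'] assms by simp
qed

lemma tour_no_reexit:
  assumes T: "T \<subseteq> E" and "i < j" "j < k" "k < l" "l < period T"
  shows "\<not> (fst (tour_at T i) \<in> D \<and> fst (tour_at T j) \<notin> D \<and> fst (tour_at T k) \<in> D
    \<and> fst (tour_at T l) \<notin> D)"
proof
  assume *: "fst (tour_at T i) \<in> D \<and> fst (tour_at T j) \<notin> D \<and> fst (tour_at T k) \<in> D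
    \<and> fst (tour_at T l) \<notin> D"
  obtain m where "m < j" "tour_at T m = (v, u)" using tour_leaves_head_side[of i j] * assms by auto
  moreover obtain m' where "m' \<ge> k" "m' < l" "tour_at T m' = (v, u)"
    using tour_leaves_head_side[of k l] * assms by auto
  ultimately show False using tour_at_inj[OF T, of m m'] assms by simp
qed

text \<open>One period after crossing the cut, the tour is back at the crossing pair and hence on
  the original side. In between it has crossed the other way.\<close>

lemma tour_crosses_back:
  assumes T: "T \<subseteq> E"
  shows "(u, v) \<in> range (tour_at T) \<longleftrightarrow> (v, u) \<in> range (tour_at T)"
proof -
  have uv: "u \<notin> D" "v \<in> D" "(u, v) \<in> T"
    using e D tail_notin_head_side[OF tree, of u v] in_head_side[of u v T] by auto
  have per: "tour_at T (i + period T) = tour_at T i" for i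
    using tour_at_mod[OF T, of "i + period T"] tour_at_mod[OF T, of i] by simp
  have le: "Suc i \<le> i + period T" for i using period_props(1)[OF T] by simp
  show ?thesis
  proof
    assume "(u, v) \<in> range (tour_at T)"
    then obtain i where i: "tour_at T i = (u, v)" by auto
    have "fst (tour_at T (Suc i)) \<in> D" using i uv by (simp add: tour_at_Suc fst_tour_step)
    moreover have "fst (tour_at T (i + period T)) \<notin> D" using i uv per by simp
    ultimately obtain m where "tour_at T m = (v, u)" using tour_leaves_head_side[OF le] by blast
    then show "(v, u) \<in> range (tour_at T)" by (rule range_eqI[OF sym])
  next
    assume "(v, u) \<in> range (tour_at T)"
    then obtain i where i: "tour_at T i = (v, u)" by auto
    have "fst (tour_at T (Suc i)) \<notin> D" using i uv by (simp add: tour_at_Suc fst_tour_step)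
    moreover have "fst (tour_at T (i + period T)) \<in> D" using i uv per by simp
    ultimately obtain m where "tour_at T m = (u, v)" using tour_enters_head_side[OF le] by blast
    then show "(u, v) \<in> range (tour_at T)" by (rule range_eqI[OF sym])
  qed
qed

end

text \<open>The visited pairs at a node are closed under rotation: a tree edge is eventually crossed
  back, and the tour then resumes at the next edge. So all edges at a visited node are visited, and
  the tree leads to every node.\<close>

lemma range_tour_at:
  assumes T: "T \<subseteq> E" "oriented_tree T"
  shows "range (tour_at T) = E"
proof
  show "range (tour_at T) \<subseteq> E" using tour_at_in[OF T(1)] by auto
  have reverse: "(y, x) \<in> range (tour_at T)"
    if "(x, y) \<in> range (tour_at T)" "(x, y) \<in> T \<union> T\<inverse>" for x y
    using tour_crosses_back[OF T(2) refl _ refl T(1)] that by blast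
  have step: "tour_step rot T e \<in> range (tour_at T)" if "e \<in> range (tour_at T)" for e
  proof -
    obtain i where "e = tour_at T i" using \<open>e \<in> range (tour_at T)\<close> by blast
    then have "tour_step rot T e = tour_at T (Suc i)" by (simp add: tour_at_Suc)
    then show ?thesis by simp
  qed
  have next_edge: "(x, rot x y) \<in> range (tour_at T)" if "(x, y) \<in> range (tour_at T)" for x y
  proof (cases "(x, y) \<in> T \<union> T\<inverse>")
    case True
    then show ?thesis using step[OF reverse[OF that True]] by (auto simp: tour_step_def)
  next
    case False
    then show ?thesis using step[OF that] by (auto simp: tour_step_def)
  qed
  have node: "(x, z) \<in> range (tour_at T)" if xy: "(x, y) \<in> range (tour_at T)" and z: "(x, z) \<in> E" for x y z
  proof -
    have "(x, y) \<in> E" using xy tour_at_in[OF T(1)] by auto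
    then have "z \<in> orbit (rot x) y"
      using rot_cyclic[of x y] z by (auto simp: cyclic_on_alldef)
    then show ?thesis by induction (auto intro: next_edge xy)
  qed
  have "\<forall>z. (w, z) \<in> E \<longrightarrow> (w, z) \<in> range (tour_at T)" for w
  proof -
    have "(b0, w) \<in> (T \<union> T\<inverse>)\<^sup>*" using T(2) by (auto simp: oriented_tree_def connected_spanning_def)
    then show ?thesis
    proof (induction rule: rtrancl_induct)
      case base
      have "(b0, b1) \<in> range (tour_at T)" using tour_at_0[of T] by (intro range_eqI[OF sym])
      then show ?case using node by blast
    next
      case (step y z)
      then have "(y, z) \<in> E" using T E_sym by blast
      then have "(z, y) \<in> range (tour_at T)" using reverse step by blast
      then show ?case using node by blast
    qed
  qed
  then show "E \<subseteq> range (tour_at T)" by auto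
qed

text \<open>\<open>E\<close> contains both orientations of each edge, so this counts node-edge
  pairs. All tours thus have the same length, and their status sequences can be compared.\<close>

lemma period_eq_card:
  assumes T: "T \<subseteq> E" "oriented_tree T"
  shows "period T = card E"
proof -
  have "tour_at T ` {..<period T} = range (tour_at T)"
  proof (intro equalityI subsetI)
    fix x assume "x \<in> range (tour_at T)"
    then obtain k where "x = tour_at T k" by auto
    then have "x = tour_at T (k mod period T)" using tour_at_mod[OF T(1)] by simp
    then show "x \<in> tour_at T ` {..<period T}" using period_props(1)[OF T(1)] by simp
  qed auto
  moreover have "inj_on (tour_at T) {..<period T}"
    using tour_at_inj[OF T(1)] by (auto intro: inj_onI)
  ultimately show ?thesis using card_image range_tour_at[OF T] by (metis card_lessThan)
qed

lemma tour_at_surj: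
  assumes T: "T \<subseteq> E" "oriented_tree T" and "e \<in> E"
  obtains k where "k < card E" "tour_at T k = e"
proof -
  obtain k where "tour_at T k = e" using range_tour_at[OF T] assms(3) by (metis rangeE)
  then show thesis
    using that[of "k mod period T"] tour_at_mod[OF T(1)] period_props(1)[OF T(1)] period_eq_card[OF T]
    by simp
qed

lemma jaeger_tree_iff:
  "jaeger_tree rot (b0, b1) G T \<longleftrightarrow> spanning_tree T G \<and>
    (\<forall>t h. (t, h) \<in> G - T \<longrightarrow>
      (\<exists>i j. i < j \<and> j < period T \<and> tour_at T i = (t, h) \<and> tour_at T j = (h, t)))"
proof -
  have "(\<exists>i j. i < j \<and> j < length (tour rot (b0, b1) T) \<and>
        tour rot (b0, b1) T ! i = (t, h) \<and> tour rot (b0, b1) T ! j = (h, t))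
    \<longleftrightarrow> (\<exists>i j. i < j \<and> j < period T \<and> tour_at T i = (t, h) \<and> tour_at T j = (h, t))" for t h
    by (intro ex_cong1) (simp add: tour_nth cong: conj_cong)
  then show ?thesis unfolding jaeger_tree_def Ball_def split_paired_All prod.case by (simp only:)
qed

subsection \<open>The first difference of two Jaeger trees\<close>

definition arcs :: "('v \<Rightarrow> int) \<Rightarrow> 'v rel" where
  "arcs l = {(u, v) \<in> E. l v - l u = 1}"

lemma arcs_subset: "arcs l \<subseteq> E"
  by (auto simp: arcs_def)

lemma arcs_antisym: "arcs l \<inter> (arcs l)\<inverse> = {}"
  by (auto simp: arcs_def)

lemma arcs_diff: "(u, v) \<in> arcs l \<Longrightarrow> l v - l u = 1"
  by (auto simp: arcs_def)

lemma layering_diff: "layering E l \<Longrightarrow> (u, v) \<in> E \<Longrightarrow> l v - l u \<le> 1 \<and> l u - l v \<le> 1"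
  by (force simp: layering_def)

text \<open>The layering itself is kept, for use as a dual solution, although a Jaeger pair records
  only its arcs and translated layerings have the same arcs.\<close>

definition jaeger_at :: "('v \<Rightarrow> int) \<Rightarrow> 'v rel \<Rightarrow> bool" where
  "jaeger_at l T \<longleftrightarrow> layering E l \<and> T \<subseteq> arcs l \<and> oriented_tree T \<and>
    (\<forall>t h. (t, h) \<in> arcs l - T \<longrightarrow>
      (\<exists>i j. i < j \<and> j < card E \<and> tour_at T i = (t, h) \<and> tour_at T j = (h, t)))"

lemma jaeger_tree_arcs_iff:
  assumes "layering E l"
  shows "jaeger_tree rot (b0, b1) (arcs l) T \<longleftrightarrow> jaeger_at l T"
proof (cases "T \<subseteq> arcs l \<and> oriented_tree T")
  case True
  then have "period T = card E" using arcs_subset by (intro period_eq_card) auto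
  then show ?thesis
    using assms True by (simp add: jaeger_tree_iff jaeger_at_def spanning_tree_iff[OF arcs_antisym])
next
  case False
  then show ?thesis
    by (auto simp: jaeger_tree_iff jaeger_at_def spanning_tree_iff[OF arcs_antisym])
qed

lemma jaeger_pairs_eq: "jaeger_pairs E rot (b0, b1) = {(arcs l, T) | l T. jaeger_at l T}"
proof -
  have facets: "facet_graphs E = {arcs l | l. layering E l}"
    by (simp add: facet_graphs_def arcs_def)
  show ?thesis
  proof (intro equalityI subsetI)
    fix p assume "p \<in> jaeger_pairs E rot (b0, b1)"
    then obtain l T where "p = (arcs l, T)" "layering E l" "jaeger_tree rot (b0, b1) (arcs l) T"
      unfolding jaeger_pairs_def facets by blast
    then show "p \<in> {(arcs l, T) | l T. jaeger_at l T}" using jaeger_tree_arcs_iff by blast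
  next
    fix p assume "p \<in> {(arcs l, T) | l T. jaeger_at l T}"
    then obtain l T where p: "p = (arcs l, T)" "jaeger_at l T" by blast
    then have "layering E l" by (simp add: jaeger_at_def)
    then show "p \<in> jaeger_pairs E rot (b0, b1)"
      using p jaeger_tree_arcs_iff unfolding jaeger_pairs_def facets by blast
  qed
qed

section \<open>Statuses and agreement of tours\<close>

definition status :: "('v \<Rightarrow> int) \<Rightarrow> 'v rel \<Rightarrow> 'v \<times> 'v \<Rightarrow> nat" where
  "status l T = edge_status (arcs l, T)"

lemma status_iff:
  assumes "layering E l" "T \<subseteq> arcs l" "(u, v) \<in> E"
  shows "status l T (u, v) = 1 \<longleftrightarrow> (v, u) \<in> T"
    and "status l T (u, v) = 2 \<longleftrightarrow> l u = l v"
    and "status l T (u, v) = 3 \<longleftrightarrow> (u, v) \<in> arcs l - T"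
    and "status l T (u, v) = 4 \<longleftrightarrow> (u, v) \<in> T"
    and "status l T (u, v) = 5 \<longleftrightarrow> (v, u) \<in> arcs l - T"
    and "1 \<le> status l T (u, v)" "status l T (u, v) \<le> 5"
proof -
  have E: "(v, u) \<in> E" using E_sym assms(3) .
  have arcs: "(u, v) \<in> arcs l \<longleftrightarrow> l v - l u = 1" "(v, u) \<in> arcs l \<longleftrightarrow> l u - l v = 1"
    using assms(3) E by (auto simp: arcs_def)
  have "l v - l u = 1 \<or> l u - l v = 1 \<or> l u = l v" using layering_diff[OF assms(1,3)] by linarith
  then consider "l v - l u = 1" "(u, v) \<in> arcs l" "(v, u) \<notin> arcs l" "(v, u) \<notin> T" "l u \<noteq> l v"
    | "l u - l v = 1" "(v, u) \<in> arcs l" "(u, v) \<notin> arcs l" "(u, v) \<notin> T" "l u \<noteq> l v"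
    | "l u = l v" "(u, v) \<notin> arcs l" "(v, u) \<notin> arcs l" "(u, v) \<notin> T" "(v, u) \<notin> T"
    using arcs assms(2) by fastforce
  then have "(status l T (u, v) = 1 \<longleftrightarrow> (v, u) \<in> T) \<and> (status l T (u, v) = 2 \<longleftrightarrow> l u = l v) \<and>
    (status l T (u, v) = 3 \<longleftrightarrow> (u, v) \<in> arcs l - T) \<and> (status l T (u, v) = 4 \<longleftrightarrow> (u, v) \<in> T) \<and>
    (status l T (u, v) = 5 \<longleftrightarrow> (v, u) \<in> arcs l - T) \<and>
    1 \<le> status l T (u, v) \<and> status l T (u, v) \<le> 5"
    by cases (simp_all add: status_def edge_status_def)
  then show "status l T (u, v) = 1 \<longleftrightarrow> (v, u) \<in> T"
    and "status l T (u, v) = 2 \<longleftrightarrow> l u = l v"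
    and "status l T (u, v) = 3 \<longleftrightarrow> (u, v) \<in> arcs l - T"
    and "status l T (u, v) = 4 \<longleftrightarrow> (u, v) \<in> T"
    and "status l T (u, v) = 5 \<longleftrightarrow> (v, u) \<in> arcs l - T"
    and "1 \<le> status l T (u, v)" "status l T (u, v) \<le> 5" by blast+
qed

definition agree :: "('v \<Rightarrow> int) \<Rightarrow> 'v rel \<Rightarrow> ('v \<Rightarrow> int) \<Rightarrow> 'v rel \<Rightarrow> nat \<Rightarrow> bool" where
  "agree l T l' T' k \<longleftrightarrow> (\<forall>i<k. status l T (tour_at T i) = status l' T' (tour_at T' i))"

definition status_less :: "('v \<Rightarrow> int) \<Rightarrow> 'v rel \<Rightarrow> ('v \<Rightarrow> int) \<Rightarrow> 'v rel \<Rightarrow> bool" where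
  "status_less l T l' T' \<longleftrightarrow> (\<exists>k<card E. agree l T l' T' k \<and>
     status l T (tour_at T k) < status l' T' (tour_at T' k))"

lemma agree_sym: "agree l T l' T' k \<longleftrightarrow> agree l' T' l T k"
  by (auto simp: agree_def)

text \<open>The status of a pair determines whether its edge is in the tree, and thereby the next
  pair.\<close>

lemma tour_agree:
  assumes l: "layering E l" "T \<subseteq> arcs l" and l': "layering E l'" "T' \<subseteq> arcs l'"
    and agree: "agree l T l' T' k" and "i \<le> k"
  shows "tour_at T i = tour_at T' i"
  using \<open>i \<le> k\<close>
proof (induction i)
  case 0
  then show ?case by (simp add: tour_at_0)
next
  case (Suc i)
  then have eq: "tour_at T i = tour_at T' i" by simp
  obtain x y where xy: "tour_at T i = (x, y)" by force
  have E: "(x, y) \<in> E" using tour_at_in[of T i] l arcs_subset xy by auto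
  have "status l T (tour_at T i) = status l' T' (tour_at T' i)"
    using agree Suc.prems by (simp add: agree_def)
  then have "status l T (x, y) = status l' T' (x, y)" using eq xy by simp
  then have "(x, y) \<in> T \<union> T\<inverse> \<longleftrightarrow> (x, y) \<in> T' \<union> T'\<inverse>"
    using status_iff(1,4)[OF l E] status_iff(1,4)[OF l' E] by auto
  moreover have "tour_at T' i = (x, y)" using eq xy by simp
  ultimately show ?case using xy by (simp add: tour_at_Suc tour_step_def)
qed

lemma agree_status:
  assumes l: "layering E l" "T \<subseteq> arcs l" and l': "layering E l'" "T' \<subseteq> arcs l'"
    and agree: "agree l T l' T' k" and "i < k" "tour_at T i = e"
  shows "status l T e = status l' T' e"
  using tour_agree[OF l l' agree, of i] assms by (auto simp: agree_def)

lemma jaeger_atD: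
  assumes "jaeger_at l T"
  shows "layering E l" "T \<subseteq> arcs l" "oriented_tree T" "T \<subseteq> E" "period T = card E"
proof -
  show *: "layering E l" "T \<subseteq> arcs l" "oriented_tree T" using assms by (auto simp: jaeger_at_def)
  show "T \<subseteq> E" using * arcs_subset by auto
  then show "period T = card E" using * by (intro period_eq_card)
qed

lemma jaeger_at_tail_first:
  assumes "jaeger_at l T" "(t, h) \<in> arcs l - T"
  obtains i j where "i < j" "j < card E" "tour_at T i = (t, h)" "tour_at T j = (h, t)"
  using assms unfolding jaeger_at_def by blast

text \<open>Status 5 means that the tail of a non-tree arc was visited earlier. There both trees had
  status 3, and this forces status 5 for both now.\<close>

lemma first_difference_status:
  assumes J: "jaeger_at l T" and J': "jaeger_at l' T'" and agree: "agree l T l' T' k"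
    and k: "k < card E" "tour_at T k = (u, v)"
    and differ: "status l T (u, v) \<noteq> status l' T' (u, v)"
  shows "status l T (u, v) \<noteq> 5"
proof
  note l = jaeger_atD(1,2)[OF J] and l' = jaeger_atD(1,2)[OF J']
  have E: "(u, v) \<in> E" using tour_at_in[OF jaeger_atD(4)[OF J], of k] k by simp
  note E' = E_sym[OF E]
  assume "status l T (u, v) = 5"
  then have vu: "(v, u) \<in> arcs l - T" using status_iff(5)[OF l E] by simp
  obtain i j where ij: "i < j" "j < card E" "tour_at T i = (v, u)" "tour_at T j = (u, v)"
    using jaeger_at_tail_first[OF J vu] .
  then have "j = k" using tour_at_inj[OF jaeger_atD(4)[OF J], of j k] jaeger_atD(5)[OF J] k by simp
  then have "status l T (v, u) = status l' T' (v, u)" using agree_status[OF l l' agree] ij by simp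
  then have "(v, u) \<in> arcs l' - T'" using vu status_iff(3)[OF l E'] status_iff(3)[OF l' E'] by simp
  then have "status l' T' (u, v) = 5" using status_iff(5)[OF l' E] by simp
  then show False using differ \<open>status l T (u, v) = 5\<close> by simp
qed

text \<open>From a base on the head side, the tour reaches \<open>u\<close> only through the pair
  \<open>(v, u)\<close>. The common status 1 there would put the arc into \<open>T'\<close> as
  well.\<close>

lemma first_difference_base_side:
  assumes J: "jaeger_at l T" and J': "jaeger_at l' T'" and agree: "agree l T l' T' k"
    and k: "tour_at T k = (u, v)" "(u, v) \<in> T"
    and differ: "status l T (u, v) \<noteq> status l' T' (u, v)"
  shows "b0 \<notin> head_side T (u, v)"
proof
  note l = jaeger_atD(1,2)[OF J] and l' = jaeger_atD(1,2)[OF J']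
  have E: "(u, v) \<in> E" using jaeger_atD(4)[OF J] k by auto
  note E' = E_sym[OF E]
  assume "b0 \<in> head_side T (u, v)"
  moreover have "u \<notin> head_side T (u, v)" using tail_notin_head_side[OF jaeger_atD(3)[OF J] k(2)] .
  ultimately obtain i where i: "i < k" "tour_at T i = (v, u)"
    using tour_leaves_head_side[OF jaeger_atD(3)[OF J] refl k(2) refl, of 0 k] k
    by (auto simp: tour_at_0)
  then have "status l T (v, u) = status l' T' (v, u)" using agree_status[OF l l' agree] by simp
  then have "(u, v) \<in> T'" using k status_iff(1)[OF l E'] status_iff(1)[OF l' E'] by simp
  then show False using differ k status_iff(4)[OF l E] status_iff(4)[OF l' E] by simp
qed

text \<open>Such an arc is visited at its tail, outside the head side, before its head, inside. If
  this came after the crossing of \<open>(u, v)\<close>, the tour would enter the head side twice.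
  So the tail was visited before step \<open>k\<close>, with status 3 for both trees.\<close>

lemma first_difference_crossing:
  assumes J: "jaeger_at l T" and J': "jaeger_at l' T'" and agree: "agree l T l' T' k"
    and k: "k < card E" "tour_at T k = (u, v)" "(u, v) \<in> T"
    and ab: "(a, b) \<in> arcs l" "(a, b) \<noteq> (u, v)" "a \<notin> head_side T (u, v)" "b \<in> head_side T (u, v)"
  shows "(a, b) \<notin> T'"
proof -
  note l = jaeger_atD(1,2)[OF J] and l' = jaeger_atD(1,2)[OF J']
  note tree = jaeger_atD(3)[OF J]
  have abT: "(a, b) \<notin> T" using head_side_crossing[OF _ ab(2)] ab by auto
  have E: "(a, b) \<in> E" using ab arcs_subset by auto
  obtain i j where ij: "i < j" "j < card E" "tour_at T i = (a, b)" "tour_at T j = (b, a)"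
    using jaeger_at_tail_first[OF J, of a b] ab abT by auto
  have uv: "u \<notin> head_side T (u, v)" "v \<in> head_side T (u, v)"
    using tail_notin_head_side[OF tree k(3)] in_head_side[OF k(3)] .
  have Suc: "fst (tour_at T (Suc k)) = v" using k by (simp add: tour_at_Suc fst_tour_step)
  have "i < k"
  proof (rule ccontr)
    assume "\<not> i < k"
    moreover have "i \<noteq> k" using ij k ab by auto
    moreover have "i \<noteq> Suc k" using ij Suc ab uv by auto
    ultimately have "Suc k < i" by simp
    then show False
      using tour_no_reentry[OF tree refl k(3) refl jaeger_atD(4)[OF J], of k "Suc k" i j]
        ij k uv Suc ab jaeger_atD(5)[OF J] by simp
  qed
  then have "status l T (a, b) = status l' T' (a, b)" using agree_status[OF l l' agree] ij by simp
  moreover have "status l T (a, b) = 3" using status_iff(3)[OF l E] ab abT by simp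
  ultimately show ?thesis using status_iff(4)[OF l' E] by auto
qed

section \<open>Layerings as dual solutions\<close>

abbreviation layer_value :: "('v \<Rightarrow> int) \<Rightarrow> real ^ 'v \<Rightarrow> real" where
  "layer_value l \<equiv> potential_value (\<lambda>w. real_of_int (l w))"

lemma layer_value_expansion:
  assumes "oriented_tree T" "set_sum UNIV x = 0"
  shows "layer_value l x = (\<Sum>(u, v)\<in>T. coord T (u, v) x * real_of_int (l v - l u))"
  unfolding linear_tree_expansion[OF assms linear_potential_value]
  by (intro sum.cong) (auto simp: potential_value_arc_vec)

lemma layer_value_eq_sum_coord:
  assumes "oriented_tree T" "T \<subseteq> arcs l" "set_sum UNIV x = 0"
  shows "layer_value l x = (\<Sum>e\<in>T. coord T e x)"
  unfolding layer_value_expansion[OF assms(1,3)]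
proof (intro sum.cong refl)
  fix e assume "e \<in> T"
  then have "l (snd e) - l (fst e) = 1" using assms(2) arcs_diff[of "fst e" "snd e" l] by auto
  then show "(case e of (u, v) \<Rightarrow> coord T (u, v) x * real_of_int (l v - l u)) = coord T e x"
    by (simp add: case_prod_beta)
qed

lemma layer_value_arc_polytope:
  assumes "oriented_tree T" "T \<subseteq> arcs l" "x \<in> arc_polytope T"
  shows "layer_value l x = 1"
  using assms in_arc_polytope_iff[OF assms(1) order_refl] layer_value_eq_sum_coord by auto

text \<open>Complementary slackness between a flow on \<open>T\<close> and a layering.\<close>
lemma tight:
  assumes T: "oriented_tree T" "T \<subseteq> E" and l: "layering E l"
    and x: "x \<in> arc_polytope T" "layer_value l x = 1"
    and uv: "(u, v) \<in> T" "0 < coord T (u, v) x"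
  shows "l v - l u = 1"
proof (rule ccontr)
  assume "l v - l u \<noteq> 1"
  moreover have le: "l b - l a \<le> 1" if "(a, b) \<in> T" for a b
    using layering_diff[OF l, of a b] T that by auto
  ultimately have lt: "l v - l u < 1" using uv(1) by (simp add: less_le)
  have x': "set_sum UNIV x = 0" "(\<Sum>e\<in>T. coord T e x) = 1" "\<And>e. e \<in> T \<Longrightarrow> 0 \<le> coord T e x"
    using x in_arc_polytope_iff[OF T(1) order_refl] by auto
  have "layer_value l x = (\<Sum>(u, v)\<in>T. coord T (u, v) x * real_of_int (l v - l u))"
    by (rule layer_value_expansion[OF T(1) x'(1)])
  also have "\<dots> < (\<Sum>e\<in>T. coord T e x)"
  proof (rule sum_strict_mono_ex1)
    show "finite T" by simp
    show "\<forall>e\<in>T. (case e of (u, v) \<Rightarrow> coord T (u, v) x * real_of_int (l v - l u)) \<le> coord T e x"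
    proof (clarsimp simp del: of_int_diff)
      fix a b assume ab: "(a, b) \<in> T"
      have "real_of_int (l b - l a) \<le> 1" using le[OF ab] by (simp only: of_int_le_1_iff)
      then show "coord T (a, b) x * real_of_int (l b - l a) \<le> coord T (a, b) x"
        using x'(3)[OF ab] mult_left_le by blast
    qed
    show "\<exists>e\<in>T. (case e of (u, v) \<Rightarrow> coord T (u, v) x * real_of_int (l v - l u)) < coord T e x"
      using uv lt by (intro bexI[of _ "(u, v)"]) auto
  qed
  finally show False using x x' by simp
qed

text \<open>Up to step \<open>k\<close> both tours cross the same tree arcs in the same directions,
  so both layerings change equally. The shift at \<open>b0\<close> accounts for the freedom to
  translate a layering.\<close>

lemma agree_layers:
  assumes J: "jaeger_at l T" and J': "jaeger_at l' T'" and agree: "agree l T l' T' k" and "i \<le> k"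
  shows "l' (fst (tour_at T i)) - l (fst (tour_at T i)) = l' b0 - l b0"
  using \<open>i \<le> k\<close>
proof (induction i)
  case 0
  then show ?case by (simp add: tour_at_0)
next
  case (Suc i)
  note l = jaeger_atD(1,2)[OF J] and l' = jaeger_atD(1,2)[OF J']
  obtain x y where xy: "tour_at T i = (x, y)" by force
  have E: "(x, y) \<in> E" using tour_at_in[of T i] jaeger_atD[OF J] xy by auto
  have st: "status l T (x, y) = status l' T' (x, y)"
    using agree_status[OF l l' agree _ xy] Suc.prems by simp
  have IH: "l' x - l x = l' b0 - l b0" using Suc xy by simp
  have "l' y - l y = l' b0 - l b0" if "(x, y) \<in> T \<union> T\<inverse>"
  proof (cases "(x, y) \<in> T")
    case True
    then have "(x, y) \<in> T'" using st status_iff(4)[OF l E] status_iff(4)[OF l' E] by simp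
    then have "l y - l x = 1" "l' y - l' x = 1"
      using True arcs_diff[of x y] l(2) l'(2) by auto
    then show ?thesis using IH by linarith
  next
    case False
    then have yx: "(y, x) \<in> T" using that by auto
    then have "(y, x) \<in> T'" using st status_iff(1)[OF l E] status_iff(1)[OF l' E] by simp
    then have "l x - l y = 1" "l' x - l' y = 1"
      using yx arcs_diff[of y x] l(2) l'(2) by auto
    then show ?thesis using IH by linarith
  qed
  then show ?case using IH xy by (simp add: tour_at_Suc fst_tour_step)
qed

text \<open>
  On the tree, \<open>l' - l\<close> is constant along the tail-edges. All other tree arcs point towards the
  base, and \<open>l' - l\<close> cannot decrease when such an arc is traversed from head to tail.
\<close>
lemma layering_growth:
  assumes T: "oriented_tree T" "T \<subseteq> arcs l" and l': "layering E l'"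
    and tail: "\<And>a b. (a, b) \<in> T \<Longrightarrow> b0 \<notin> head_side T (a, b) \<Longrightarrow> l' b - l' a = 1"
  shows "l' b0 - l b0 \<le> l' w - l w"
proof -
  let ?f = "potential_value (\<lambda>w. real_of_int (l' w - l w))"
  \<comment> \<open>\<open>arc_vec (b0, w)\<close> is the unit flow along the tree path from
    \<open>b0\<close> to \<open>w\<close>: it is nonpositive on arcs whose head side contains the
    base, and so is the change of \<open>l' - l\<close> there.\<close>
  have "?f (arc_vec (b0, w)) = (\<Sum>e\<in>T. coord T e (arc_vec (b0, w)) * ?f (arc_vec e))"
    by (rule linear_tree_expansion[OF T(1) balanced_arc_vec linear_potential_value])
  also have "\<dots> \<ge> 0"
  proof (rule sum_nonneg)
    fix e assume e: "e \<in> T"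
    obtain a b where ab: "e = (a, b)" by force
    have "(a, b) \<in> arcs l" using e ab T(2) by auto
    then have l: "l b - l a = 1" and E: "(a, b) \<in> E" using arcs_diff arcs_subset by blast+
    have f: "?f (arc_vec e) = real_of_int (l' b - l' a - 1)"
      using l by (simp add: ab potential_value_arc_vec)
    show "0 \<le> coord T e (arc_vec (b0, w)) * ?f (arc_vec e)"
    proof (cases "b0 \<in> head_side T e")
      case True
      have "l' b - l' a - 1 \<le> 0" using layering_diff[OF l' E] by linarith
      then have "?f (arc_vec e) \<le> 0" unfolding f by (simp only: of_int_le_0_iff)
      moreover have "coord T e (arc_vec (b0, w)) \<le> 0" using True by (simp add: coord_arc_vec_sides)
      ultimately show ?thesis by (rule mult_nonpos_nonpos[rotated])
    next
      case False
      then have "?f (arc_vec e) = 0" unfolding f using tail[of a b] e ab by simp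
      then show ?thesis by simp
    qed
  qed
  finally have "0 \<le> real_of_int (l' w - l w) - real_of_int (l' b0 - l b0)"
    by (simp only: potential_value_arc_vec)
  then show ?thesis by linarith
qed

lemma coord_nonneg: "oriented_tree T \<Longrightarrow> x \<in> arc_polytope T \<Longrightarrow> e \<in> T \<Longrightarrow> 0 \<le> coord T e x"
  using in_arc_polytope_iff[of T T x] by auto

lemma arc_polytope_balanced: "oriented_tree T \<Longrightarrow> x \<in> arc_polytope T \<Longrightarrow> set_sum UNIV x = 0"
  using in_arc_polytope_iff[of T T x] by auto

text \<open>The tail-edge depends on the two trees only and not on \<open>x\<close>, so one facet
  contains the whole intersection of the two simplices.\<close>

lemma first_difference_tail_edge:
  assumes J: "jaeger_at l T" and J': "jaeger_at l' T'" and less: "status_less l' T' l T"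
  obtains e where "e \<in> T" "b0 \<notin> head_side T e"
    "\<And>x. x \<in> arc_polytope T \<Longrightarrow> x \<in> arc_polytope T' \<Longrightarrow> coord T e x = 0"
proof -
  note l = jaeger_atD(1,2)[OF J] and l' = jaeger_atD(1,2)[OF J']
  note tree = jaeger_atD(3)[OF J] and tree' = jaeger_atD(3)[OF J']
  note TE = jaeger_atD(4)[OF J] and TE' = jaeger_atD(4)[OF J']
  obtain k where k: "k < card E" and agree': "agree l' T' l T k"
    and lt: "status l' T' (tour_at T' k) < status l T (tour_at T k)"
    using less unfolding status_less_def by blast
  have agree: "agree l T l' T' k" using agree' agree_sym by simp
  obtain u v where uv: "tour_at T k = (u, v)" by force
  have uv': "tour_at T' k = (u, v)" using tour_agree[OF l l' agree order_refl] uv by simp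
  have E: "(u, v) \<in> E" using tour_at_in[OF TE, of k] uv by simp
  have lt: "status l' T' (u, v) < status l T (u, v)" using lt uv uv' by simp
  have ne5: "status l T (u, v) \<noteq> 5"
    using first_difference_status[OF J J' agree k uv] lt by simp
  have tight': "l' b - l' a = 1"
    if "x \<in> arc_polytope T" "x \<in> arc_polytope T'" "(a, b) \<in> T" "coord T (a, b) x \<noteq> 0" for x a b
    using tight[OF tree TE l'(1) that(1) layer_value_arc_polytope[OF tree' l'(2) that(2)] that(3)]
      coord_nonneg[OF tree that(1,3)] that(4) by simp
  have tight: "l b - l a = 1"
    if "x \<in> arc_polytope T" "x \<in> arc_polytope T'" "(a, b) \<in> T'" "coord T' (a, b) x \<noteq> 0" for x a b
    using tight[OF tree' TE' l(1) that(2) layer_value_arc_polytope[OF tree l(2) that(1)] that(3)]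
      coord_nonneg[OF tree' that(2,3)] that(4) by simp
  show thesis
  proof (cases "status l T (u, v) = 4")
    case True
    then have uvT: "(u, v) \<in> T" using status_iff(4)[OF l E] by simp
    have uvT': "(u, v) \<notin> T'" using status_iff(4)[OF l' E] lt True by simp
    let ?D = "head_side T (u, v)"
    show thesis
    proof (rule that[OF uvT])
      show "b0 \<notin> ?D" using first_difference_base_side[OF J J' agree uv uvT] lt by simp
      fix x assume x: "x \<in> arc_polytope T" "x \<in> arc_polytope T'"
      \<comment> \<open>The flow across the cut of \<open>(u, v)\<close> is recomputed in
        \<open>T'\<close>. Arcs of \<open>T'\<close> with flow are tight for \<open>l\<close>, and
        no such arc enters the cut.\<close>
      have "coord T (u, v) x = (\<Sum>e\<in>T'. coord T' e x * set_sum ?D (arc_vec e))"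
        unfolding coord_def[of T "(u, v)"]
        by (rule linear_tree_expansion[OF tree' arc_polytope_balanced[OF tree' x(2)] linear_set_sum])
      also have "\<dots> \<le> 0"
      proof (rule sum_nonpos)
        fix e assume e: "e \<in> T'"
        obtain a b where ab: "e = (a, b)" by force
        show "coord T' e x * set_sum ?D (arc_vec e) \<le> 0"
        proof (cases "coord T' e x = 0 \<or> a \<in> ?D \<or> b \<notin> ?D")
          case True
          then show ?thesis using coord_nonneg[OF tree' x(2) e]
            by (auto simp: ab set_sum_arc_vec)
        next
          case False
          have "(a, b) \<in> E" using e ab TE' by auto
          then have "(a, b) \<in> arcs l" using tight[OF x, of a b] e ab False by (simp add: arcs_def)
          then have "(a, b) \<notin> T'"
            using first_difference_crossing[OF J J' agree k uv uvT, of a b] False uvT' e ab by auto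
          then show ?thesis using e ab by simp
        qed
      qed
      finally show "coord T (u, v) x = 0" using coord_nonneg[OF tree x(1) uvT] by simp
    qed
  next
    case False
    have "1 \<le> status l' T' (u, v)" "status l T (u, v) \<le> 5"
      using status_iff(6)[OF l' E] status_iff(7)[OF l E] by auto
    \<comment> \<open>Statuses 1, 2 and 3 mean that the layering changes by -1, 0 and 1 from
      \<open>u\<close> to \<open>v\<close>, so the smaller status has the smaller rise.\<close>
    then consider "status l T (u, v) = 3" "status l' T' (u, v) = 1"
      | "status l T (u, v) = 3" "status l' T' (u, v) = 2"
      | "status l T (u, v) = 2" "status l' T' (u, v) = 1"
      using lt ne5 False by linarith
    then have "l' v - l' u < l v - l u"
    proof cases
      case 1
      then have "(u, v) \<in> arcs l" "(v, u) \<in> arcs l'"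
        using status_iff(3)[OF l E] status_iff(1)[OF l' E] l'(2) by auto
      then show ?thesis using arcs_diff[of u v l] arcs_diff[of v u l'] by simp
    next
      case 2
      then have "(u, v) \<in> arcs l" "l' u = l' v"
        using status_iff(3)[OF l E] status_iff(2)[OF l' E] by auto
      then show ?thesis using arcs_diff[of u v l] by simp
    next
      case 3
      then have "l u = l v" "(v, u) \<in> arcs l'"
        using status_iff(2)[OF l E] status_iff(1)[OF l' E] l'(2) by auto
      then show ?thesis using arcs_diff[of v u l'] by simp
    qed
    moreover have "l' u - l u = l' b0 - l b0"
      using agree_layers[OF J J' agree order_refl] uv by simp
    \<comment> \<open>The layerings match at \<open>u\<close> up to the shift at the base, so
      \<open>l'\<close> is too low at \<open>v\<close>. By \<open>layering_growth\<close> some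
      tail-edge is not tight for \<open>l'\<close>, and common points carry no flow on it.\<close>
    ultimately have "\<not> l' b0 - l b0 \<le> l' v - l v" by linarith
    then obtain a b where ab: "(a, b) \<in> T" "b0 \<notin> head_side T (a, b)" "l' b - l' a \<noteq> 1"
      using layering_growth[OF tree l(2) l'(1)] by blast
    then show thesis using that[OF ab(1,2)] tight' by blast
  qed
qed

text \<open>The tour of a tree visits every pair, so agreement along a full period compares all
  edges.\<close>

lemma status_eq_imp_eq:
  assumes J: "jaeger_at l T" and J': "jaeger_at l' T'" and agree: "agree l T l' T' (card E)"
  shows "T = T' \<and> arcs l = arcs l'"
proof -
  note l = jaeger_atD(1,2)[OF J] and l' = jaeger_atD(1,2)[OF J']
  have st: "status l T e = status l' T' e" if "e \<in> E" for e
    by (rule tour_at_surj[OF jaeger_atD(4,3)[OF J] that]) (rule agree_status[OF l l' agree])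
  have "e \<in> T \<longleftrightarrow> e \<in> T'" "e \<in> arcs l - T \<longleftrightarrow> e \<in> arcs l' - T'" if "e \<in> E" for e
  proof -
    obtain u v where e: "e = (u, v)" by force
    have E: "(u, v) \<in> E" using that e by simp
    show "e \<in> T \<longleftrightarrow> e \<in> T'" "e \<in> arcs l - T \<longleftrightarrow> e \<in> arcs l' - T'"
      using st[OF that] status_iff(3,4)[OF l E] status_iff(3,4)[OF l' E] by (auto simp: e)
  qed
  then show ?thesis using l l' jaeger_atD(4)[OF J] jaeger_atD(4)[OF J'] arcs_subset by blast
qed

lemma status_less_total:
  assumes J: "jaeger_at l T" and J': "jaeger_at l' T'" and ne: "\<not> (T = T' \<and> arcs l = arcs l')"
  shows "status_less l T l' T' \<or> status_less l' T' l T"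
proof -
  define P where "P k \<longleftrightarrow> k < card E \<and> status l T (tour_at T k) \<noteq> status l' T' (tour_at T' k)" for k
  have "\<exists>k. P k" using status_eq_imp_eq[OF J J'] ne by (auto simp: agree_def P_def)
  then obtain m where m: "P m" "\<And>i. i < m \<Longrightarrow> \<not> P i" using exists_least_iff[of P] by blast
  have "agree l T l' T' m" unfolding agree_def
  proof (intro allI impI)
    fix i assume "i < m"
    then show "status l T (tour_at T i) = status l' T' (tour_at T' i)"
      using m(2)[of i] m(1) by (simp add: P_def)
  qed
  then have "agree l T l' T' m" "agree l' T' l T m" using agree_sym by simp_all
  then show ?thesis using m(1) unfolding status_less_def P_def neq_iff by blast
qed

section \<open>Points just beyond a tail facet\<close>

text \<open>If \<open>f\<close> vanishes on all tree arcs but \<open>e\<close>, its value along the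
  path from the base to \<open>w\<close> depends only on whether the path crosses
  \<open>e\<close>.\<close>

lemma single_edge_expansion:
  fixes f :: "real ^ 'v \<Rightarrow> real"
  assumes "oriented_tree T" "linear f" "e \<in> T" "\<And>e'. e' \<in> T \<Longrightarrow> e' \<noteq> e \<Longrightarrow> f (arc_vec e') = 0"
  shows "f (arc_vec (b0, w)) = coord T e (arc_vec (b0, w)) * f (arc_vec e)"
proof -
  have "f (arc_vec (b0, w)) = (\<Sum>e'\<in>T. coord T e' (arc_vec (b0, w)) * f (arc_vec e'))"
    by (rule linear_tree_expansion[OF assms(1) balanced_arc_vec assms(2)])
  also have "\<dots> = (\<Sum>e'\<in>{e}. coord T e' (arc_vec (b0, w)) * f (arc_vec e'))"
    using assms(3,4) by (intro sum.mono_neutral_right) auto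
  finally show ?thesis by simp
qed

text \<open>
  The point \<open>x\<close> lies inside the facet opposite to the tail-edge \<open>(u, v)\<close>, and \<open>z\<close> lies just
  beyond that facet, in the cone over the simplex of \<open>T'\<close>. If \<open>T\<close> came first, then either the
  layerings or the cuts of the two trees at the first difference would put \<open>z\<close> on the wrong side.
\<close>
lemma perturbation_less:
  assumes J: "jaeger_at l T" and J': "jaeger_at l' T'"
    and uv: "(u, v) \<in> T" "b0 \<notin> head_side T (u, v)"
    and x: "x \<in> rel_interior (arc_polytope (T - {(u, v)}))" "x \<in> arc_polytope T'"
    and z: "\<And>e. e \<in> T' \<Longrightarrow> 0 \<le> coord T' e z" "coord T (u, v) z < 0"
  shows "status_less l' T' l T"
proof (rule ccontr)
  assume not_less: "\<not> status_less l' T' l T"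
  note l = jaeger_atD(1,2)[OF J] and l' = jaeger_atD(1,2)[OF J']
  note tree = jaeger_atD(3)[OF J] and tree' = jaeger_atD(3)[OF J']
  note TE = jaeger_atD(4)[OF J] and TE' = jaeger_atD(4)[OF J']
  let ?D = "head_side T (u, v)"
  have "T \<noteq> T'" using z uv by force
  then have less: "status_less l T l' T'" using status_less_total[OF J J'] not_less by blast
  then obtain k where k: "k < card E" and agree: "agree l T l' T' k"
    and lt: "status l T (tour_at T k) < status l' T' (tour_at T' k)"
    unfolding status_less_def by blast
  have agree': "agree l' T' l T k" using agree agree_sym by simp
  obtain p q where pq: "tour_at T k = (p, q)" by force
  have pq': "tour_at T' k = (p, q)" using tour_agree[OF l l' agree order_refl] pq by simp
  have E: "(p, q) \<in> E" using tour_at_in[OF TE, of k] pq by simp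
  have lt: "status l T (p, q) < status l' T' (p, q)" using lt pq pq' by simp
  have ne5: "status l' T' (p, q) \<noteq> 5"
    using first_difference_status[OF J' J agree' k pq'] lt by simp
  have x': "set_sum UNIV x = 0" "\<And>e. e \<in> T \<Longrightarrow> e \<noteq> (u, v) \<Longrightarrow> 0 < coord T e x"
    "coord T (u, v) x = 0" "(\<Sum>e\<in>T. coord T e x) = 1"
    using x(1) uv(1) in_rel_interior_arc_polytope_iff[OF tree, of "T - {(u, v)}"] by auto
  then have xT: "x \<in> arc_polytope T"
    unfolding in_arc_polytope_iff[OF tree order_refl] by (auto intro: less_imp_le) (metis less_imp_le order_refl)
  have tight': "l' b - l' a = 1" if "(a, b) \<in> T" "(a, b) \<noteq> (u, v)" for a b
    using tight[OF tree TE l'(1) xT layer_value_arc_polytope[OF tree' l'(2) x(2)] that(1) x'(2)[OF that]] .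
  define c where "c = l' v - l' u - 1"
  have c: "c \<le> 0" using layering_diff[OF l'(1), of u v] TE uv by (auto simp: c_def)
  \<comment> \<open>At \<open>x\<close> every tree arc except \<open>(u, v)\<close> carries flow and
    is tight for \<open>l'\<close>. So \<open>l' - l\<close> is constant on each side of the cut and
    jumps by \<open>c\<close> across it.\<close>
  have d: "l' w - l w = l' b0 - l b0 + (if w \<in> ?D then c else 0)" for w
  proof -
    let ?f = "potential_value (\<lambda>w. real_of_int (l' w - l w))"
    have "?f (arc_vec (a, b)) = 0" if "(a, b) \<in> T" "(a, b) \<noteq> (u, v)" for a b
      using tight'[OF that] arcs_diff[of a b l] l(2) that by (auto simp: potential_value_arc_vec)
    then have "?f (arc_vec (b0, w)) = coord T (u, v) (arc_vec (b0, w)) * ?f (arc_vec (u, v))"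
      by (intro single_edge_expansion[OF tree linear_potential_value uv(1)]) auto
    moreover have "?f (arc_vec (u, v)) = real_of_int c"
      using arcs_diff[of u v l] l(2) uv(1) by (auto simp: potential_value_arc_vec c_def)
    ultimately have "real_of_int (l' w - l w) - real_of_int (l' b0 - l b0)
        = real_of_int (if w \<in> ?D then c else 0)"
      using uv(2) by (simp add: potential_value_arc_vec coord_arc_vec_sides)
    then show ?thesis by linarith
  qed
  show False
  proof (cases "status l T (p, q) = 3 \<and> status l' T' (p, q) = 4")
    case True
    then have pqT: "(p, q) \<notin> T" and pqT': "(p, q) \<in> T'"
      using status_iff(3)[OF l E] status_iff(4)[OF l' E] by auto
    let ?D' = "head_side T' (p, q)"
    have base: "b0 \<notin> ?D'" using first_difference_base_side[OF J' J agree' pq' pqT'] lt by simp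
    have nonpos: "coord T e x * set_sum ?D' (arc_vec e) \<le> 0" if e: "e \<in> T" for e
    proof -
      obtain a b where ab: "e = (a, b)" by force
      show ?thesis
      proof (cases "e = (u, v) \<or> a \<in> ?D' \<or> b \<notin> ?D'")
        case True
        then show ?thesis using coord_nonneg[OF tree xT e] x'(3)
          by (auto simp: ab set_sum_arc_vec)
      next
        case False
        have "(a, b) \<in> E" using e ab TE by auto
        then have "(a, b) \<in> arcs l'" using tight'[of a b] e ab False by (simp add: arcs_def)
        then have "(a, b) \<notin> T"
          using first_difference_crossing[OF J' J agree' k pq' pqT', of a b] False pqT e ab by auto
        then show ?thesis using e ab by simp
      qed
    qed
    have "coord T' (p, q) x = (\<Sum>e\<in>T. coord T e x * set_sum ?D' (arc_vec e))"
      unfolding coord_def[of T' "(p, q)"] by (rule linear_tree_expansion[OF tree x'(1) linear_set_sum])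
    moreover have "0 \<le> coord T' (p, q) x" by (rule coord_nonneg[OF tree' x(2) pqT'])
    \<comment> \<open>A sum of nonpositive terms is nonnegative, so every term vanishes: no flow of
      \<open>x\<close> crosses the cut of \<open>(p, q)\<close>.\<close>
    ultimately have zero: "coord T e x * set_sum ?D' (arc_vec e) = 0" if "e \<in> T" for e
      using nonpos that sum_nonpos[of T "\<lambda>e. coord T e x * set_sum ?D' (arc_vec e)"]
        sum_nonneg_eq_0_iff[of T "\<lambda>e. - (coord T e x * set_sum ?D' (arc_vec e))"]
      by (simp add: sum_negf)
    have "set_sum ?D' (arc_vec e) = 0" if "e \<in> T" "e \<noteq> (u, v)" for e
      using zero[OF that(1)] x'(2)[OF that] by simp
    then have expansion: "set_sum ?D' (arc_vec (b0, w))
        = coord T (u, v) (arc_vec (b0, w)) * set_sum ?D' (arc_vec (u, v))" for w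
      by (intro single_edge_expansion[OF tree linear_set_sum uv(1)])
    define r where "r = set_sum ?D' (arc_vec (u, v))"
    \<comment> \<open>Among the arcs of \<open>T\<close>, only \<open>(u, v)\<close> can cross the
      boundary of \<open>?D'\<close>. So \<open>?D'\<close> is either empty or equal to
      \<open>?D\<close>, and it contains \<open>q\<close>.\<close>
    have side: "w \<in> ?D' \<longleftrightarrow> w \<in> ?D \<and> r = 1" for w
    proof -
      have "of_bool (w \<in> ?D') = of_bool (w \<in> ?D) * r"
        using expansion[of w] base uv(2) unfolding r_def[symmetric] coord_arc_vec_sides
        by (simp only: set_sum_arc_vec of_bool_eq diff_zero)
      moreover have "r \<in> {-1, 0, 1}" by (auto simp: r_def set_sum_arc_vec)
      ultimately show ?thesis by (cases "w \<in> ?D'"; cases "w \<in> ?D") auto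
    qed
    then have "?D' = ?D" using in_head_side[OF pqT'] by blast
    then have "coord T' (p, q) z = coord T (u, v) z" by (simp add: coord_def)
    then show False using z(1)[OF pqT'] z(2) by simp
  next
    case False
    have "1 \<le> status l T (p, q)" "status l' T' (p, q) \<le> 5"
      using status_iff(6)[OF l E] status_iff(7)[OF l' E] by auto
    then consider "status l T (p, q) = 1" "status l' T' (p, q) = 2"
      | "status l T (p, q) = 1" "status l' T' (p, q) = 3 \<or> status l' T' (p, q) = 4"
      | "status l T (p, q) = 2" "status l' T' (p, q) = 3 \<or> status l' T' (p, q) = 4"
      using lt ne5 False by linarith
    then have "l q - l p < l' q - l' p"
    proof cases
      case 1
      then have "(q, p) \<in> arcs l" "l' p = l' q"
        using status_iff(1)[OF l E] status_iff(2)[OF l' E] l(2) by auto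
      then show ?thesis using arcs_diff[of q p l] by simp
    next
      case 2
      then have "(q, p) \<in> arcs l" "(p, q) \<in> arcs l'"
        using status_iff(1)[OF l E] status_iff(3,4)[OF l' E] l(2) l'(2) by auto
      then show ?thesis using arcs_diff[of q p l] arcs_diff[of p q l'] by simp
    next
      case 3
      then have "l p = l q" "(p, q) \<in> arcs l'"
        using status_iff(2)[OF l E] status_iff(3,4)[OF l' E] l'(2) by auto
      then show ?thesis using arcs_diff[of p q l'] by simp
    qed
    \<comment> \<open>\<open>l' - l\<close> grows from \<open>p\<close> to \<open>q\<close> while
      \<open>c\<close> is at most 0, so \<open>p\<close> is inside and \<open>q\<close> outside. The
      tour has then already crossed \<open>(u, v)\<close>, with equal statuses, and the arc is tight
      for \<open>l'\<close> after all.\<close>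
    then have "p \<in> ?D" "c \<noteq> 0" using d[of p] d[of q] c by (auto split: if_splits)
    then obtain i where i: "i < k" "tour_at T i = (u, v)"
      using tour_enters_head_side[OF tree refl uv(1) refl, of 0 k] uv(2) pq by (auto simp: tour_at_0)
    have uvE: "(u, v) \<in> E" using uv TE by auto
    have "status l T (u, v) = status l' T' (u, v)" using agree_status[OF l l' agree] i by simp
    then have "(u, v) \<in> T'" using uv status_iff(4)[OF l uvE] status_iff(4)[OF l' uvE] by simp
    then have "c = 0" using arcs_diff[of u v l'] l'(2) by (auto simp: c_def)
    then show False using \<open>c \<noteq> 0\<close> by simp
  qed
qed

subsection \<open>Jaeger trees cover the boundary\<close>

lemma root_polytope_eq: "root_polytope E = convex hull (arc_vec ` E)"
proof -
  have "(\<Union>(u, v)\<in>E. {axis u 1 - axis v 1, axis v 1 - axis u 1}) = (arc_vec ` E :: (real ^ 'v) set)"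
    using E_sym by (force simp: arc_vec_def)
  then show ?thesis by (simp add: root_polytope_def)
qed

lemma convex_root_polytope: "convex (root_polytope E)"
  by (simp add: root_polytope_eq)

lemma rel_frontier_root_polytope: "rel_frontier (root_polytope E) = root_polytope E - rel_interior (root_polytope E)"
proof -
  have "compact (root_polytope E)"
    unfolding root_polytope_eq by (intro compact_convex_hull finite_imp_compact) simp
  then show ?thesis by (simp add: rel_frontier_def closure_closed compact_imp_closed)
qed

lemma arc_vec_flip: "- arc_vec (u, v) = arc_vec (v, u)"
  by (simp add: arc_vec_def)

lemma minus_root_polytope:
  assumes "x \<in> root_polytope E"
  shows "- x \<in> root_polytope E"
proof -
  have "uminus ` (arc_vec ` E) = (arc_vec ` E :: (real ^ 'v) set)"
  proof (intro equalityI subsetI)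
    fix y :: "real ^ 'v" assume "y \<in> uminus ` (arc_vec ` E)"
    then show "y \<in> arc_vec ` E" using E_sym by (auto simp: arc_vec_flip)
  next
    fix y :: "real ^ 'v" assume "y \<in> arc_vec ` E"
    then obtain u v where "(u, v) \<in> E" "y = arc_vec (u, v)" by auto
    then have "y = - arc_vec (v, u)" "(v, u) \<in> E" using E_sym by (simp_all add: arc_vec_flip)
    then show "y \<in> uminus ` (arc_vec ` E)" by blast
  qed
  moreover have "linear (uminus :: real ^ 'v \<Rightarrow> _)" by (rule linearI) auto
  ultimately have "uminus ` root_polytope E = root_polytope E"
    unfolding root_polytope_eq by (simp add: convex_hull_linear_image)
  then show ?thesis using assms by blast
qed

text \<open>By central symmetry, the segment from any point to the origin extends to the opposite
  point, which is the factor 2 in the criterion.\<close>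

lemma zero_in_rel_interior: "0 \<in> rel_interior (root_polytope E)"
proof -
  have "arc_vec (b0, b1) \<in> root_polytope E"
    unfolding root_polytope_eq using base by (intro hull_inc) auto
  then have "root_polytope E \<noteq> {}" by auto
  moreover have "\<exists>e>1. (1 - e) *\<^sub>R x + e *\<^sub>R 0 \<in> root_polytope E" if "x \<in> root_polytope E" for x
    using minus_root_polytope[OF that] by (intro exI[of _ 2]) simp
  ultimately show ?thesis using convex_rel_interior_iff[OF convex_root_polytope] by blast
qed

lemma layer_value_le_1:
  assumes "layering E l" "x \<in> root_polytope E"
  shows "layer_value l x \<le> 1"
proof -
  have "layer_value l (arc_vec e) \<le> 1" if e: "e \<in> E" for e
  proof -
    obtain u v where uv: "e = (u, v)" by force
    have "real_of_int (l v - l u) \<le> 1"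
      using layering_diff[OF assms(1), of u v] e uv by (simp only: of_int_le_1_iff)
    then show ?thesis by (simp add: uv potential_value_arc_vec)
  qed
  then have "root_polytope E \<subseteq> {x. layer_value l x \<le> 1}"
    unfolding root_polytope_eq
    by (intro hull_minimal linear_le_imp_convex linear_potential_value) auto
  then show ?thesis using assms(2) by blast
qed

lemma arc_polytope_mono: "A \<subseteq> B \<Longrightarrow> arc_polytope A \<subseteq> arc_polytope B"
  unfolding arc_polytope_eq by (intro hull_mono image_mono)

text \<open>The layering is at most 1 on the polytope and equal to 1 on the simplex. From the
  relative interior one could move further away from the origin and exceed 1.\<close>

lemma arc_polytope_subset_rel_frontier:
  assumes "jaeger_at l T"
  shows "arc_polytope T \<subseteq> rel_frontier (root_polytope E)"
proof
  fix x assume x: "x \<in> arc_polytope T"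
  have xP: "x \<in> root_polytope E"
    using x arc_polytope_mono[OF jaeger_atD(4)[OF assms]] by (auto simp: root_polytope_eq arc_polytope_eq)
  have fx: "layer_value l x = 1" using layer_value_arc_polytope[OF jaeger_atD(3,2)[OF assms] x] .
  have "x \<notin> rel_interior (root_polytope E)"
  proof
    assume "x \<in> rel_interior (root_polytope E)"
    moreover have "0 \<in> root_polytope E" using zero_in_rel_interior rel_interior_subset by blast
    ultimately obtain e where "e > 1" "(1 - e) *\<^sub>R 0 + e *\<^sub>R x \<in> root_polytope E"
      using convex_rel_interior_iff[OF convex_root_polytope, of x] xP by blast
    then have "layer_value l (e *\<^sub>R x) \<le> 1" using layer_value_le_1[OF jaeger_atD(1)[OF assms]] by simp
    then show False using fx \<open>e > 1\<close> by (simp add: linear_scale[OF linear_potential_value])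
  qed
  then show "x \<in> rel_frontier (root_polytope E)" using xP by (simp add: rel_frontier_root_polytope)
qed

section \<open>From boundary points to layerings and trees\<close>

text \<open>A supporting functional is divided by its value at \<open>x\<close>. This value is
  negative because the origin lies in the relative interior, so the inequality turns into an upper
  bound.\<close>

lemma supporting_potential:
  assumes x: "x \<in> rel_frontier (root_polytope E)"
  obtains a where "\<And>u v. (u, v) \<in> E \<Longrightarrow> a v - a u \<le> 1" "potential_value a x = 1"
proof -
  have xP: "x \<in> root_polytope E" "x \<notin> rel_interior (root_polytope E)"
    using x by (auto simp: rel_frontier_root_polytope)
  obtain c where c: "\<And>y. y \<in> root_polytope E \<Longrightarrow> c \<bullet> x \<le> c \<bullet> y"
    "\<And>y. y \<in> rel_interior (root_polytope E) \<Longrightarrow> c \<bullet> x < c \<bullet> y"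
    using supporting_hyperplane_rel_boundary[OF convex_root_polytope xP] by metis
  have neg: "c \<bullet> x < 0" using c(2)[OF zero_in_rel_interior] by simp
  define a where "a w = c $ w / (c \<bullet> x)" for w
  have a: "potential_value a y = (c \<bullet> y) / (c \<bullet> x)" for y
    by (simp add: potential_value_def a_def inner_vec_def sum_divide_distrib)
  show thesis
  proof (rule that[of a])
    show "potential_value a x = 1" using neg a by simp
    fix u v assume "(u, v) \<in> E"
    then have "arc_vec (u, v) \<in> root_polytope E"
      unfolding root_polytope_eq by (intro hull_inc) auto
    then have "potential_value a (arc_vec (u, v)) \<le> 1"
      unfolding a using c(1) neg by (simp add: divide_le_eq)
    then show "a v - a u \<le> 1" by (simp only: potential_value_arc_vec)
  qed
qed

text \<open>Among the supporting potentials, one with the largest tight component of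
  \<open>b0\<close> is taken. By \<open>grow_tight_component\<close> this component is everything,
  and then all differences are integers.\<close>

lemma facet_cover:
  assumes x: "x \<in> rel_frontier (root_polytope E)"
  obtains l where "layering E l" "connected_spanning (arcs l)" "x \<in> arc_polytope (arcs l)"
proof -
  define A where "A a = {(u, v) \<in> E. a v - a u = (1 :: real)}" for a
  define C where "C a = (A a \<union> (A a)\<inverse>)\<^sup>* `` {b0}" for a
  define Q where "Q a \<longleftrightarrow> (\<forall>(u, v)\<in>E. a v - a u \<le> 1) \<and> potential_value a x = 1" for a
  have xP: "x \<in> convex hull (arc_vec ` E)"
  proof -
    have "x \<in> root_polytope E" using x rel_frontier_root_polytope by auto
    then show ?thesis by (simp add: root_polytope_eq)
  qed
  have tight: "x \<in> arc_polytope (A a)" if "Q a" for a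
  proof -
    have "x \<in> convex hull {y \<in> arc_vec ` E. potential_value a y = 1}"
      using that xP unfolding Q_def
      by (intro convex_hull_tight linear_potential_value) (auto simp: potential_value_arc_vec)
    also have "{y \<in> arc_vec ` E. potential_value a y = 1} = arc_vec ` A a"
      by (auto simp: A_def potential_value_arc_vec)
    finally show ?thesis by (simp add: arc_polytope_eq)
  qed
  obtain a0 where "\<forall>u v. (u, v) \<in> E \<longrightarrow> a0 v - a0 u \<le> 1" "potential_value a0 x = 1"
    using supporting_potential[OF x] by metis
  then have "Q a0" by (auto simp: Q_def)
  moreover have "\<forall>a. Q a \<longrightarrow> card (C a) < Suc CARD('v)"
    by (simp add: less_Suc_eq_le card_mono)
  ultimately obtain a where a: "Q a" "\<And>a'. Q a' \<Longrightarrow> card (C a') \<le> card (C a)"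
    using Lattices_Big.ex_has_greatest_nat[of Q a0 "\<lambda>a. card (C a)" "Suc CARD('v)"] by blast
  have "C a = UNIV"
  proof (rule ccontr)
    assume ne: "C a \<noteq> UNIV"
    have symE: "sym E" using simple by (simp add: simple_graph_def)
    have Ca: "C a = ({(u, v) \<in> E. a v - a u = 1} \<union> {(u, v) \<in> E. a v - a u = 1}\<inverse>)\<^sup>* `` {b0}"
      by (simp add: C_def A_def)
    have le: "a v - a u \<le> 1" if "(u, v) \<in> E" for u v using a(1) that by (auto simp: Q_def)
    show False
    proof (rule grow_tight_component[OF connected symE le Ca ne])
      fix d
      assume d: "\<And>u v. (u, v) \<in> E \<Longrightarrow>
          (a v + d * of_bool (v \<notin> C a)) - (a u + d * of_bool (u \<notin> C a)) \<le> 1"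
        "\<exists>u v. (u, v) \<in> E \<and> u \<in> C a \<and> v \<notin> C a \<and>
          (a v + d * of_bool (v \<notin> C a)) - (a u + d * of_bool (u \<notin> C a)) = 1"
      define a' where "a' w = a w + d * of_bool (w \<notin> C a)" for w
      have cross: "u \<in> C a \<longleftrightarrow> v \<in> C a" if "(u, v) \<in> A a" for u v
        using that unfolding C_def by (auto intro: rtrancl_into_rtrancl)
      \<comment> \<open>\<open>x\<close> is a combination of tight arcs, none of which crosses the
        boundary of the component. So lifting the complement does not change the value at
        \<open>x\<close>.\<close>
      have "arc_polytope (A a) \<subseteq> {y. set_sum (- C a) y = 0}"
        unfolding arc_polytope_eq
        by (intro hull_minimal affine_imp_convex linear_eq_imp_affine linear_set_sum)
          (auto simp: set_sum_arc_vec cross)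
      then have zero: "set_sum (- C a) x = 0" using tight[OF a(1)] by auto
      have "potential_value a' x = potential_value a x + d * (\<Sum>w\<in>UNIV. if w \<in> - C a then x $ w else 0)"
        by (simp add: potential_value_def a'_def sum.distrib[symmetric] sum_distrib_left algebra_simps)
          (intro sum.cong, auto)
      also have "(\<Sum>w\<in>UNIV. if w \<in> - C a then x $ w else 0) = set_sum (- C a) x"
        by (simp add: set_sum_def sum.If_cases Compl_eq)
      finally have "potential_value a' x = 1" using a(1) zero by (simp add: Q_def)
      moreover have "a' v - a' u \<le> 1" if "(u, v) \<in> E" for u v
        using d(1)[OF that] by (simp only: a'_def)
      ultimately have "Q a'" unfolding Q_def by blast
      have sub: "A a \<subseteq> A a'" using cross by (auto simp: A_def a'_def)
      have "C a \<subseteq> C a'" unfolding C_def using sub by (intro Image_mono rtrancl_mono) auto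
      moreover obtain u v where uv: "(u, v) \<in> A a'" "u \<in> C a" "v \<notin> C a"
        using d(2) unfolding A_def a'_def by blast
      moreover have "v \<in> C a'"
        using uv \<open>C a \<subseteq> C a'\<close> unfolding C_def by (auto intro: rtrancl_into_rtrancl)
      ultimately have "C a \<subset> C a'" by blast
      then have "card (C a) < card (C a')" by (intro psubset_card_mono) auto
      then show False using a(2)[OF \<open>Q a'\<close>] by simp
    qed
  qed
  then have reach: "(b0, w) \<in> (A a \<union> (A a)\<inverse>)\<^sup>*" for w by (auto simp: C_def)
  then have conn: "connected_spanning (A a)"
    unfolding connected_spanning_def by (meson rtrancl_trans sym_rtrancl_sym)
  \<comment> \<open>Tight arcs change the potential by 1 and connect everything, so the floor only
    converts the type.\<close>
  define l where "l w = \<lfloor>a w - a b0\<rfloor>" for w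
  have l: "real_of_int (l w) = a w - a b0" for w
  proof -
    have "a w - a b0 \<in> \<int>" using reach[of w]
    proof (induction rule: rtrancl_induct)
      case base
      then show ?case by simp
    next
      case (step y z)
      have "a z - a y = 1 \<or> a z - a y = - 1" using step(2) by (auto simp: A_def)
      then have "a z - a y \<in> \<int>" by (metis Ints_1 Ints_minus)
      then show ?case using Ints_add[OF step.IH] by fastforce
    qed
    then show ?thesis by (simp add: l_def)
  qed
  have diff: "real_of_int (l v - l u) = a v - a u" for u v using l by simp
  have arcs: "arcs l = A a"
    unfolding arcs_def A_def diff[symmetric] by (simp only: of_int_eq_1_iff)
  have "layering E l"
    unfolding layering_def
  proof (intro conjI ballI, clarify)
    fix u v assume uv: "(u, v) \<in> E"
    have "a v - a u \<le> 1" "a u - a v \<le> 1" using a(1) uv E_sym[OF uv] by (auto simp: Q_def)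
    then show "\<bar>l u - l v\<bar> \<le> 1" unfolding diff[symmetric] by (simp only: of_int_le_1_iff)
  next
    have "arcs l \<subseteq> {(u, v) \<in> E. \<bar>l u - l v\<bar> = 1}" by (auto simp: arcs_def)
    then show "connected_spanning {(u, v) \<in> E. \<bar>l u - l v\<bar> = 1}"
      using conn unfolding arcs[symmetric] connected_spanning_def
      by (meson Un_mono converse_mono rtrancl_mono subsetD)
  qed
  then show thesis using that conn tight[OF a(1)] arcs by simp
qed

text \<open>All arc vectors of a facet lie in the hyperplane of layer value 1. So Caratheodory
  yields a linearly independent set, which extends to a tree.\<close>

lemma tree_cover:
  assumes l: "layering E l" "connected_spanning (arcs l)" and x: "x \<in> arc_polytope (arcs l)"
  obtains T where "T \<subseteq> arcs l" "oriented_tree T" "x \<in> arc_polytope T"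
proof -
  have "layer_value l y = 1" if y: "y \<in> arc_vec ` arcs l" for y
  proof -
    obtain u v where uv: "(u, v) \<in> arcs l" "y = arc_vec (u, v)" using y by auto
    have "real_of_int (l v - l u) = 1" using arcs_diff[OF uv(1)] by simp
    then show ?thesis by (simp add: uv potential_value_arc_vec)
  qed
  then obtain B where B: "B \<subseteq> arc_vec ` arcs l" "independent B" "x \<in> convex hull B"
    using caratheodory_independent[of "arc_vec ` arcs l" "layer_value l" x] x
      linear_potential_value unfolding arc_polytope_eq by (metis finite finite_imageI)
  have "(v, v) \<notin> arcs l" for v using E_irrefl arcs_subset by blast
  then obtain T where "T \<subseteq> arcs l" "oriented_tree T" "B \<subseteq> arc_vec ` T"
    using extend_to_oriented_tree[OF l(2) _ B(1,2)] by blast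
  then show thesis using that B(3) hull_mono unfolding arc_polytope_eq by blast
qed

section \<open>Minimal trees and exchange of arcs\<close>

lemma status_less_irrefl: "\<not> status_less l T l T"
  by (simp add: status_less_def)

lemma status_less_trans:
  assumes "status_less l T l' T'" "status_less l' T' l'' T''"
  shows "status_less l T l'' T''"
proof -
  obtain i where i: "i < card E" "agree l T l' T' i"
    "status l T (tour_at T i) < status l' T' (tour_at T' i)"
    using assms(1) unfolding status_less_def by blast
  obtain j where j: "j < card E" "agree l' T' l'' T'' j"
    "status l' T' (tour_at T' j) < status l'' T'' (tour_at T'' j)"
    using assms(2) unfolding status_less_def by blast
  have "agree l T l'' T'' (min i j)" using i(2) j(2) by (simp add: agree_def)
  moreover have "status l T (tour_at T (min i j)) < status l'' T'' (tour_at T'' (min i j))"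
    using i j by (cases i j rule: linorder_cases) (auto simp: agree_def min_def)
  moreover have "min i j < card E" using i(1) by simp
  ultimately show ?thesis unfolding status_less_def by blast
qed

text \<open>Only the tour of \<open>T\<close> has to be inspected; the tour of \<open>T'\<close>
  follows it by induction.\<close>

lemma agreeI:
  assumes l: "layering E l" "T \<subseteq> arcs l" and l': "layering E l'" "T' \<subseteq> arcs l'"
    and "\<And>i. i < m \<Longrightarrow> status l T (tour_at T i) = status l' T' (tour_at T i)"
  shows "agree l T l' T' m"
  using assms(5)
proof (induction m)
  case 0
  then show ?case by (simp add: agree_def)
next
  case (Suc m)
  then have agree: "agree l T l' T' m" by simp
  then have "tour_at T m = tour_at T' m" using tour_agree[OF l l' _ order_refl] by blast
  moreover have "status l T (tour_at T m) = status l' T' (tour_at T m)" using Suc.prems by simp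
  ultimately show ?case using agree by (auto simp: agree_def less_Suc_eq)
qed

text \<open>
  Pushing flow along the fundamental cycle of \<open>(t, h)\<close> until a tree arc \<open>e\<close> on which it
  runs backwards becomes empty.
\<close>
lemma tree_exchange:
  assumes T: "oriented_tree T" "T \<subseteq> arcs l" and th: "(t, h) \<in> arcs l - T"
    and x: "x \<in> arc_polytope T"
  obtains e where "e \<in> T" "h \<in> head_side T e" "t \<notin> head_side T e"
    "oriented_tree (insert (t, h) (T - {e}))" "x \<in> arc_polytope (insert (t, h) (T - {e}))"
proof -
  define c where "c e = coord T e (arc_vec (t, h))" for e
  \<comment> \<open>The arcs that the tree path from \<open>t\<close> to \<open>h\<close> follows
    forwards. They lose flow when it is rerouted through \<open>(t, h)\<close>.\<close>
  define M where "M = {e \<in> T. h \<in> head_side T e \<and> t \<notin> head_side T e}"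
  have x': "set_sum UNIV x = 0" "(\<Sum>e\<in>T. coord T e x) = 1" "\<And>e. e \<in> T \<Longrightarrow> 0 \<le> coord T e x"
    using x in_arc_polytope_iff[OF T(1) order_refl] by auto
  have arc: "arc_vec (t, h) = (\<Sum>e\<in>T. c e *\<^sub>R arc_vec e)"
    unfolding c_def by (rule tree_expansion[OF T(1) balanced_arc_vec])
  have layer: "layer_value l (arc_vec e) = 1" if "e \<in> arcs l" for e
  proof -
    obtain u v where "e = (u, v)" by force
    then show ?thesis using that arcs_diff[of u v l] by (simp add: potential_value_arc_vec flip: of_int_diff)
  qed
  \<comment> \<open>Every arc rises by one layer, so the coefficients of \<open>(t, h)\<close> add
    up to 1. Hence one of them is positive and \<open>M\<close> is not empty.\<close>
  have "(\<Sum>e\<in>T. c e) = (\<Sum>e\<in>T. c e * layer_value l (arc_vec e))"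
    using layer T(2) by (intro sum.cong) auto
  also have "\<dots> = layer_value l (arc_vec (t, h))"
    unfolding c_def by (rule linear_tree_expansion[OF T(1) balanced_arc_vec linear_potential_value, symmetric])
  finally have sum_c: "(\<Sum>e\<in>T. c e) = 1" using layer th by simp
  have c_M: "c e = 1" if "e \<in> M" for e using that by (simp add: M_def c_def coord_arc_vec_sides)
  have c_not_M: "c e \<le> 0" if "e \<in> T" "e \<notin> M" for e
    using that by (auto simp: M_def c_def coord_arc_vec_sides)
  have "M \<noteq> {}"
  proof
    assume "M = {}"
    then have "(\<Sum>e\<in>T. c e) \<le> 0" using c_not_M by (intro sum_nonpos) auto
    then show False using sum_c by simp
  qed
  moreover have "finite M" by simp
  \<comment> \<open>The bottleneck: its flow is the most that can be rerouted without making an arc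
    of \<open>M\<close> negative.\<close>
  ultimately obtain e where e: "e \<in> M" "\<And>e'. e' \<in> M \<Longrightarrow> coord T e x \<le> coord T e' x"
    using arg_min_if_finite[of M "\<lambda>e. coord T e x"] by (metis not_less)
  have eT: "e \<in> T" "h \<in> head_side T e" "t \<notin> head_side T e" using e(1) by (auto simp: M_def)
  let ?T' = "insert (t, h) (T - {e})"
  have thT: "(t, h) \<notin> T" using th by simp
  have "card ?T' = card T" using eT thT by (simp add: card_Diff_singleton card_gt_0_iff) (metis Suc_pred card_gt_0_iff empty_iff finite)
  then have card: "card ?T' \<le> CARD('v) - 1" using card_oriented_tree[OF T(1)] by simp
  \<comment> \<open>The coefficient of \<open>e\<close> in the expansion of \<open>(t, h)\<close> is
    1, so \<open>e\<close> can be solved for and the exchanged arcs still span.\<close>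
  have "arc_vec ` T \<subseteq> span (arc_vec ` ?T')"
  proof clarify
    fix a b assume ab: "(a, b) \<in> T"
    show "arc_vec (a, b) \<in> span (arc_vec ` ?T')"
    proof (cases "(a, b) = e")
      case True
      have "arc_vec (t, h) = c e *\<^sub>R arc_vec e + (\<Sum>e\<in>T - {e}. c e *\<^sub>R arc_vec e)"
        using arc eT by (simp add: sum.remove)
      then have "arc_vec e = arc_vec (t, h) - (\<Sum>e\<in>T - {e}. c e *\<^sub>R arc_vec e)"
        using c_M[OF e(1)] by simp
      moreover have "\<dots> \<in> span (arc_vec ` ?T')"
        by (intro span_diff span_sum span_mul) (auto intro: span_base)
      ultimately show ?thesis using True by simp
    next
      case False
      then show ?thesis using ab by (intro span_base) auto
    qed
  qed
  moreover have "connected_spanning T" using T(1) by (simp add: oriented_tree_def)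
  ultimately have conn: "connected_spanning ?T'" using span_imp_connected by blast
  have tree: "oriented_tree ?T'" using connected_card_imp_oriented_tree[OF conn card] .
  define r where "r = coord T e x"
  define g where "g e' = (if e' = (t, h) then r else coord T e' x - r * c e')" for e'
  have g_e: "coord T e x - r * c e = 0" using c_M[OF e(1)] by (simp add: r_def)
  have g_sum: "sum g ?T' = 1"
  proof -
    have "sum g ?T' = r + (\<Sum>e'\<in>T - {e}. coord T e' x - r * c e')"
      using thT by (simp add: g_def) (intro sum.cong, auto)
    also have "(\<Sum>e'\<in>T - {e}. coord T e' x - r * c e') = (\<Sum>e'\<in>T. coord T e' x - r * c e')"
      using eT(1) g_e by (simp add: sum.remove)
    also have "\<dots> = 1 - r" by (simp add: sum_subtractf x'(2) sum_c flip: sum_distrib_left)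
    finally show ?thesis by simp
  qed
  have g_vec: "(\<Sum>e'\<in>?T'. g e' *\<^sub>R arc_vec e') = x"
  proof -
    have "(\<Sum>e'\<in>?T'. g e' *\<^sub>R arc_vec e')
        = r *\<^sub>R arc_vec (t, h) + (\<Sum>e'\<in>T - {e}. (coord T e' x - r * c e') *\<^sub>R arc_vec e')"
      using thT by (simp add: g_def) (intro sum.cong, auto)
    also have "(\<Sum>e'\<in>T - {e}. (coord T e' x - r * c e') *\<^sub>R arc_vec e')
        = (\<Sum>e'\<in>T. (coord T e' x - r * c e') *\<^sub>R arc_vec e')"
      using eT(1) g_e by (simp add: sum.remove)
    also have "\<dots> = (\<Sum>e'\<in>T. coord T e' x *\<^sub>R arc_vec e') - r *\<^sub>R (\<Sum>e'\<in>T. c e' *\<^sub>R arc_vec e')"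
      by (simp add: scaleR_diff_left sum_subtractf scaleR_sum_right)
    also have "\<dots> = x - r *\<^sub>R arc_vec (t, h)"
      using tree_expansion[OF T(1) x'(1)] arc by simp
    finally show ?thesis by simp
  qed
  have "0 \<le> r" using x'(3)[OF eT(1)] by (simp add: r_def)
  have "0 \<le> g e'" if "e' \<in> ?T'" for e'
  proof -
    have "0 \<le> coord T e' x - r * c e'" if "e' \<in> T"
    proof (cases "e' \<in> M")
      case True
      then show ?thesis using c_M e(2) by (simp add: r_def)
    next
      case False
      then have "r * c e' \<le> 0" using c_not_M[OF that] \<open>0 \<le> r\<close> by (simp add: mult_nonneg_nonpos)
      then show ?thesis using x'(3)[OF that] by simp
    qed
    then show ?thesis using \<open>0 \<le> r\<close> that by (auto simp: g_def)
  qed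
  then have "(\<Sum>e'\<in>?T'. g e' *\<^sub>R arc_vec e') \<in> arc_polytope ?T'"
    unfolding arc_polytope_eq using g_sum by (intro convex_sum) (auto intro: hull_inc)
  then show thesis using that[OF eT tree] g_vec by simp
qed

text \<open>Statuses change only at the two exchanged edges. At \<open>(h, t)\<close> the status
  drops from 5 to 1 and at the tail of \<open>e\<close> from 4 to 3. The head of \<open>e\<close>
  cannot come first, since the tour would then have to leave the head side twice.\<close>

lemma exchange_less:
  assumes l: "layering E l" and T: "oriented_tree T" "T \<subseteq> arcs l" and th: "(t, h) \<in> arcs l - T"
    and e: "e \<in> T" "h \<in> head_side T e" "t \<notin> head_side T e"
    and ji: "j < i" "i < card E" "tour_at T i = (t, h)" "tour_at T j = (h, t)"
  shows "status_less l (insert (t, h) (T - {e})) l T"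
proof -
  let ?T' = "insert (t, h) (T - {e})"
  obtain p q where pq: "e = (p, q)" by force
  have TE: "T \<subseteq> E" using T(2) arcs_subset by blast
  have period: "period T = card E" using period_eq_card[OF TE T(1)] .
  have T': "?T' \<subseteq> arcs l" using T(2) th by auto
  \<comment> \<open>The pair \<open>(t, h)\<close> can be left out, since it is visited only after
    \<open>(h, t)\<close>.\<close>
  define P where "P m \<longleftrightarrow> tour_at T m \<in> {(h, t), (p, q), (q, p)}" for m
  have "P j" using ji by (simp add: P_def)
  then obtain m where m: "P m" "\<And>i. i < m \<Longrightarrow> \<not> P i" using exists_least_iff[of P] by blast
  have "m \<le> j" using m(2)[of j] \<open>P j\<close> by (cases "j < m") auto
  have same: "status l ?T' (tour_at T k) = status l T (tour_at T k)" if "k < m" for k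
  proof -
    obtain a b where ab: "tour_at T k = (a, b)" by force
    have "k \<noteq> i" "k < period T" using that \<open>m \<le> j\<close> ji period by auto
    then have "tour_at T k \<noteq> tour_at T i" using tour_at_inj[OF TE, of k i] ji period by auto
    then have "(a, b) \<notin> {(h, t), (t, h), (p, q), (q, p)}"
      using m(2)[OF that] ab ji(3) by (auto simp: P_def)
    then have "(a, b) \<in> ?T' \<longleftrightarrow> (a, b) \<in> T" "(b, a) \<in> ?T' \<longleftrightarrow> (b, a) \<in> T" using pq by auto
    then show ?thesis by (simp only: ab status_def edge_status_def prod.case Diff_iff)
  qed
  have agree': "agree l T l ?T' m" using agreeI[OF l T(2) l T'] same by simp
  then have agree: "agree l ?T' l T m" using agree_sym by simp
  have tour: "tour_at ?T' m = tour_at T m" using tour_agree[OF l T(2) l T' agree' order_refl] by simp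
  have thE: "(h, t) \<in> E" "(t, h) \<in> E" using th arcs_subset E_sym by blast+
  have pqE: "(p, q) \<in> E" "(p, q) \<in> T" "(p, q) \<in> arcs l" using e(1) pq TE T(2) by auto
  have "status l ?T' (tour_at T m) < status l T (tour_at T m)"
  proof -
    consider "tour_at T m = (h, t)" | "tour_at T m = (p, q)" | "tour_at T m = (q, p)"
      using m(1) by (auto simp: P_def)
    then show ?thesis
    proof cases
      case 1
      have "status l T (h, t) = 5" using status_iff(5)[OF l T(2) thE(1)] th by simp
      moreover have "status l ?T' (h, t) = 1" using status_iff(1)[OF l T' thE(1)] by simp
      ultimately show ?thesis using 1 by simp
    next
      case 2
      have "status l T (p, q) = 4" using status_iff(4)[OF l T(2) pqE(1)] pqE by simp
      moreover have "status l ?T' (p, q) = 3"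
        using status_iff(3)[OF l T' pqE(1)] pqE pq th by auto
      ultimately show ?thesis using 2 by simp
    next
      case 3
      have D: "q \<in> head_side T e" "p \<notin> head_side T e"
        using in_head_side[OF pqE(2)] tail_notin_head_side[OF T(1) pqE(2)] pq by auto
      have Suc: "fst (tour_at T (Suc m)) = p" using 3 pqE by (simp add: tour_at_Suc fst_tour_step)
      have "m \<noteq> j"
      proof
        assume "m = j"
        then have "(p, q) = (t, h)" using 3 ji by simp
        then show False using pqE th by simp
      qed
      moreover have "Suc m \<noteq> j" using Suc ji e D by auto
      ultimately have "Suc m < j" using \<open>m \<le> j\<close> by simp
      then show ?thesis
        using tour_no_reexit[OF T(1) pq e(1) refl TE, of m "Suc m" j i] 3 Suc D e ji period by simp
    qed
  qed
  moreover have "m < card E" using \<open>m \<le> j\<close> ji by simp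
  ultimately show ?thesis unfolding status_less_def using agree tour by (intro exI[of _ m]) simp
qed

lemma jaeger_cover:
  assumes x: "x \<in> rel_frontier (root_polytope E)"
  obtains l T where "jaeger_at l T" "x \<in> arc_polytope T"
proof -
  obtain l where l: "layering E l" "connected_spanning (arcs l)" "x \<in> arc_polytope (arcs l)"
    using facet_cover[OF x] .
  define \<T> where "\<T> = {T. T \<subseteq> arcs l \<and> oriented_tree T \<and> x \<in> arc_polytope T}"
  have fin: "finite \<T>" by simp
  have ne: "\<T> \<noteq> {}" using tree_cover[OF l] unfolding \<T>_def by blast
  have trans: "transp_on \<T> (\<lambda>T T'. status_less l T l T')"
    by (rule transp_onI) (rule status_less_trans)
  have "asymp_on \<T> (\<lambda>T T'. status_less l T l T')"
    by (rule asymp_onI) (metis status_less_irrefl status_less_trans)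
  from Finite_Set.bex_min_element[OF fin this trans ne]
  obtain T where T: "T \<in> \<T>" and min: "\<forall>T'\<in>\<T>. T' \<noteq> T \<longrightarrow> \<not> status_less l T' l T"
    by (rule bexE)
  have T': "T \<subseteq> arcs l" "oriented_tree T" "x \<in> arc_polytope T" using T by (auto simp: \<T>_def)
  have TE: "T \<subseteq> E" using T'(1) arcs_subset by blast
  have "\<exists>i j. i < j \<and> j < card E \<and> tour_at T i = (t, h) \<and> tour_at T j = (h, t)"
    if th: "(t, h) \<in> arcs l - T" for t h
  proof -
    have E: "(t, h) \<in> E" "(h, t) \<in> E" using th arcs_subset E_sym by blast+
    obtain i where i: "i < card E" "tour_at T i = (t, h)" using tour_at_surj[OF TE T'(2) E(1)] .
    obtain j where j: "j < card E" "tour_at T j = (h, t)" using tour_at_surj[OF TE T'(2) E(2)] .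
    have "t \<noteq> h" using E E_irrefl by blast
    then have "i \<noteq> j" using i(2) j(2) by force
    moreover have "\<not> j < i"
    proof
      assume ji: "j < i"
      obtain e where e: "e \<in> T" "h \<in> head_side T e" "t \<notin> head_side T e"
        "oriented_tree (insert (t, h) (T - {e}))" "x \<in> arc_polytope (insert (t, h) (T - {e}))"
        using tree_exchange[OF T'(2,1) th T'(3)] .
      have less: "status_less l (insert (t, h) (T - {e})) l T"
        using exchange_less[OF l(1) T'(2,1) th e(1-3) ji i j(2)] .
      have "insert (t, h) (T - {e}) \<subseteq> arcs l" using T'(1) th by blast
      then have "insert (t, h) (T - {e}) \<in> \<T>" using e(4,5) by (simp add: \<T>_def)
      moreover have "insert (t, h) (T - {e}) \<noteq> T" using th by blast
      ultimately show False using less min[rule_format] by simp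
    qed
    ultimately have "i < j" by simp
    then show ?thesis using i j by blast
  qed
  then have "jaeger_at l T" unfolding jaeger_at_def using l(1) T' by blast
  then show thesis using that T'(3) by blast
qed

text \<open>The ray from the origin through \<open>z\<close> meets the relative frontier, and the
  signs of the coordinates are unaffected by scaling.\<close>

lemma jaeger_cone_cover:
  assumes z: "set_sum UNIV z = 0" "z \<noteq> 0"
  obtains l T where "jaeger_at l T" "\<And>e. e \<in> T \<Longrightarrow> 0 \<le> coord T e z"
proof -
  have zero: "0 \<in> root_polytope E" using zero_in_rel_interior rel_interior_subset by blast
  have "z \<in> span (arc_vec ` E)" using balanced_in_span[OF connected z(1)] .
  also have "\<dots> \<subseteq> span (root_polytope E)"
    unfolding root_polytope_eq by (intro span_mono hull_subset)
  also have "\<dots> = affine hull root_polytope E" using affine_hull_span_0[OF hull_inc[OF zero]] by simp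
  finally have aff: "0 + z \<in> affine hull root_polytope E" by simp
  have "bounded (root_polytope E)"
    unfolding root_polytope_eq by (intro bounded_convex_hull finite_imp_bounded) simp
  then obtain d where d: "0 < d" "0 + d *\<^sub>R z \<in> rel_frontier (root_polytope E)"
    using ray_to_rel_frontier[OF _ zero_in_rel_interior aff z(2)] by blast
  then have "d *\<^sub>R z \<in> rel_frontier (root_polytope E)" by simp
  then obtain l T where lT: "jaeger_at l T" "d *\<^sub>R z \<in> arc_polytope T" using jaeger_cover by blast
  have "0 \<le> coord T e z" if "e \<in> T" for e
  proof -
    have "0 \<le> coord T e (d *\<^sub>R z)" using coord_nonneg[OF jaeger_atD(3)[OF lT(1)] lT(2) that] .
    then show ?thesis using d(1) by (simp add: linear_scale[OF linear_coord] zero_le_mult_iff)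
  qed
  then show thesis using that lT(1) by blast
qed

subsection \<open>The shelling\<close>

text \<open>A negative value at \<open>x\<close> would outweigh the perturbation for all large
  \<open>n\<close>, and \<open>N\<close> contains arbitrarily large \<open>n\<close>.\<close>

lemma coord_limit:
  fixes x y :: "real ^ 'v"
  assumes inf: "infinite N" and N: "\<And>n. n \<in> N \<Longrightarrow> 0 \<le> coord T e (x - (1 / real (Suc n)) *\<^sub>R y)"
  shows "0 \<le> coord T e x"
proof (rule ccontr)
  assume "\<not> 0 \<le> coord T e x"
  then have neg: "coord T e x < 0" by simp
  obtain m where m: "coord T e y / coord T e x < real m" using reals_Archimedean2 by blast
  obtain n where n: "n \<in> N" "m \<le> n" using inf unfolding infinite_nat_iff_unbounded_le by blast
  have "coord T e y / coord T e x < real (Suc n)" using m n(2) by simp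
  then have "coord T e x * real (Suc n) < coord T e y"
    using neg by (simp add: divide_less_eq mult.commute)
  then have "coord T e x < coord T e y / real (Suc n)"
    by (simp add: less_divide_eq)
  then have "coord T e (x - (1 / real (Suc n)) *\<^sub>R y) < 0"
    by (simp add: linear_diff[OF linear_coord] linear_scale[OF linear_coord])
  then show False using N[OF n(1)] by simp
qed

lemma layer_value_arc_le_1:
  assumes "layering E l" "e \<in> E"
  shows "layer_value l (arc_vec e) \<le> 1"
  using assms by (intro layer_value_le_1) (auto simp: root_polytope_eq intro: hull_inc)

text \<open>The total flow on \<open>T'\<close> is the value of \<open>l'\<close>, hence at most 1.
  As \<open>l\<close> rises by at most 1 along each arc, the total is also at least the value 1 of
  \<open>l\<close>.\<close>

lemma cone_in_arc_polytope:
  assumes l: "layering E l" and x: "x \<in> root_polytope E" "set_sum UNIV x = 0" "layer_value l x = 1"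
    and J': "jaeger_at l' T'" and nonneg: "\<And>e. e \<in> T' \<Longrightarrow> 0 \<le> coord T' e x"
  shows "x \<in> arc_polytope T'"
proof -
  note tree' = jaeger_atD(3)[OF J']
  have "layer_value l' x = (\<Sum>e\<in>T'. coord T' e x)"
    by (rule layer_value_eq_sum_coord[OF tree' jaeger_atD(2)[OF J'] x(2)])
  then have "(\<Sum>e\<in>T'. coord T' e x) \<le> 1"
    using layer_value_le_1[OF jaeger_atD(1)[OF J'] x(1)] by simp
  moreover have "1 \<le> (\<Sum>e\<in>T'. coord T' e x)"
  proof -
    have "layer_value l x = (\<Sum>e\<in>T'. coord T' e x * layer_value l (arc_vec e))"
      by (rule linear_tree_expansion[OF tree' x(2) linear_potential_value])
    also have "\<dots> \<le> (\<Sum>e\<in>T'. coord T' e x)"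
      using layer_value_arc_le_1[OF l] jaeger_atD(4)[OF J'] nonneg
      by (intro sum_mono) (meson mult_left_le subsetD)
    finally show ?thesis using x(3) by simp
  qed
  ultimately show ?thesis
    unfolding in_arc_polytope_iff[OF tree' order_refl] using x(2) nonneg by auto
qed

text \<open>The points \<open>z n\<close> lie beyond the facet and converge to \<open>x\<close>. As
  there are finitely many trees, one tree serves infinitely many of them, and its cone contains the
  limit \<open>x\<close>.\<close>

lemma tail_facet_interior_covered:
  assumes J: "jaeger_at l T" and e: "e \<in> T" "b0 \<notin> head_side T e"
    and x: "x \<in> rel_interior (arc_polytope (T - {e}))"
  obtains l' T' where "jaeger_at l' T'" "status_less l' T' l T" "x \<in> arc_polytope T'"
proof -
  note tree = jaeger_atD(3)[OF J]
  obtain u v where uv: "e = (u, v)" by force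
  have xA: "x \<in> arc_polytope (T - {e})" using x rel_interior_subset by blast
  then have xT: "x \<in> arc_polytope T" using arc_polytope_mono[of "T - {e}" T] by blast
  have xP: "x \<in> root_polytope E"
    using xT arc_polytope_subset_rel_frontier[OF J] rel_frontier_root_polytope by blast
  have x0: "set_sum UNIV x = 0" using arc_polytope_balanced[OF tree xT] .
  have xe: "coord T e x = 0" using xA e(1) in_arc_polytope_iff[OF tree, of "T - {e}"] by auto
  define z where "z n = x - (1 / real (Suc n)) *\<^sub>R arc_vec e" for n
  have z0: "set_sum UNIV (z n) = 0" for n
    by (simp add: z_def x0 balanced_arc_vec linear_diff[OF linear_set_sum] linear_scale[OF linear_set_sum])
  have ze: "coord T e (z n) < 0" for n
    using coord_arc_vec[OF tree e(1) e(1)]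
    by (simp add: z_def xe linear_diff[OF linear_coord] linear_scale[OF linear_coord])
  have "\<exists>T'. (\<exists>l'. jaeger_at l' T') \<and> (\<forall>e'\<in>T'. 0 \<le> coord T' e' (z n))" for n
  proof -
    have "z n \<noteq> 0" using ze[of n] linear_0[OF linear_coord, of T e] by (metis less_irrefl)
    from jaeger_cone_cover[OF z0 this]
    obtain l' T' where "jaeger_at l' T'" "\<forall>e'\<in>T'. 0 \<le> coord T' e' (z n)" by metis
    then show ?thesis by blast
  qed
  then have "\<forall>n. \<exists>T'. (\<exists>l'. jaeger_at l' T') \<and> (\<forall>e'\<in>T'. 0 \<le> coord T' e' (z n))" by blast
  from choice[OF this] obtain f
    where f: "\<forall>n. (\<exists>l'. jaeger_at l' (f n)) \<and> (\<forall>e'\<in>f n. 0 \<le> coord (f n) e' (z n))" ..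
  have "finite (f ` UNIV)" by simp
  then obtain n0 where inf: "infinite {n \<in> UNIV. f n = f n0}"
    using pigeonhole_infinite[OF infinite_UNIV_nat] by blast
  obtain l' where J': "jaeger_at l' (f n0)" using f by blast
  have "0 \<le> coord (f n0) e' x" if e': "e' \<in> f n0" for e'
  proof (rule coord_limit[OF inf])
    fix n assume "n \<in> {n \<in> UNIV. f n = f n0}"
    then have "f n = f n0" by simp
    then show "0 \<le> coord (f n0) e' (x - (1 / real (Suc n)) *\<^sub>R arc_vec e)"
      using f[rule_format, of n] e' unfolding z_def by simp
  qed
  then have xT': "x \<in> arc_polytope (f n0)"
    by (intro cone_in_arc_polytope[OF jaeger_atD(1)[OF J] xP x0
          layer_value_arc_polytope[OF tree jaeger_atD(2)[OF J] xT] J'])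
  have "\<And>e'. e' \<in> f n0 \<Longrightarrow> 0 \<le> coord (f n0) e' (z n0)" using f by blast
  then have "status_less l' (f n0) l T"
    using perturbation_less[OF J J', of u v x "z n0"] e x xT' ze[of n0] uv by simp
  then show thesis using that J' xT' by blast
qed

lemma closed_arc_polytope: "closed (arc_polytope A)"
  unfolding arc_polytope_eq by (intro compact_imp_closed compact_convex_hull finite_imp_compact) simp

text \<open>The earlier simplices form a finite union of closed sets, and the facet is contained in
  the closure of its relative interior.\<close>

lemma tail_facet_covered:
  assumes J: "jaeger_at l T" and e: "e \<in> T" "b0 \<notin> head_side T e"
    and x: "x \<in> arc_polytope (T - {e})"
  obtains l' T' where "jaeger_at l' T'" "status_less l' T' l T" "x \<in> arc_polytope T'"
proof -
  define W where "W = (\<Union>T'\<in>{T'. \<exists>l'. jaeger_at l' T' \<and> status_less l' T' l T}. arc_polytope T')"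
  have "closed W" unfolding W_def by (intro closed_UN ballI closed_arc_polytope) simp
  moreover have "rel_interior (arc_polytope (T - {e})) \<subseteq> W"
    using tail_facet_interior_covered[OF J e] unfolding W_def by blast
  ultimately have "closure (rel_interior (arc_polytope (T - {e}))) \<subseteq> W"
    by (intro closure_minimal)
  moreover have "convex (arc_polytope (T - {e}))" by (simp add: arc_polytope_eq)
  ultimately have "arc_polytope (T - {e}) \<subseteq> W"
    using convex_closure_rel_interior closure_subset by blast
  then show thesis using x that unfolding W_def by blast
qed

section \<open>The quadratic order and the dissection\<close>

lemma quadratic_order_iff:
  assumes J: "jaeger_at l T" and J': "jaeger_at l' T'"
  shows "((arcs l, T), (arcs l', T')) \<in> quadratic_order E rot (b0, b1) \<longleftrightarrow> status_less l T l' T'"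
proof -
  define s where "s l T = map (edge_status (arcs l, T)) (tour rot (b0, b1) T)" for l T
  have s: "length (s l T) = card E" "\<And>i. i < card E \<Longrightarrow> s l T ! i = status l T (tour_at T i)"
    if "jaeger_at l T" for l T
    using jaeger_atD(5)[OF that] by (simp_all add: s_def tour_nth status_def)
  have take: "take k (s l T) = take k (s l' T') \<longleftrightarrow> agree l T l' T' k" if "k < card E" for k
    using that s[OF J] s[OF J'] by (simp add: list_eq_iff_nth_eq agree_def)
  have "(arcs l, T) \<in> jaeger_pairs E rot (b0, b1)" "(arcs l', T') \<in> jaeger_pairs E rot (b0, b1)"
    using J J' by (auto simp: jaeger_pairs_eq)
  then have "((arcs l, T), (arcs l', T')) \<in> quadratic_order E rot (b0, b1) \<longleftrightarrow>
    (\<exists>k. k < length (s l T) \<and> k < length (s l' T') \<and> take k (s l T) = take k (s l' T')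
      \<and> s l T ! k < s l' T' ! k)"
    by (simp add: quadratic_order_def s_def Let_def)
  also have "\<dots> \<longleftrightarrow> status_less l T l' T'"
    using s[OF J] s[OF J'] take unfolding status_less_def by auto
  finally show ?thesis .
qed

abbreviation J :: "('v rel \<times> 'v rel) set" where
  "J \<equiv> jaeger_pairs E rot (b0, b1)"

abbreviation less4 :: "('v rel \<times> 'v rel) rel" where
  "less4 \<equiv> quadratic_order E rot (b0, b1)"

lemma JE:
  assumes "p \<in> J"
  obtains l T where "p = (arcs l, T)" "jaeger_at l T"
  using assms unfolding jaeger_pairs_eq by blast

lemma JI: "jaeger_at l T \<Longrightarrow> (arcs l, T) \<in> J"
  unfolding jaeger_pairs_eq by blast

lemma less4_field: "(p, q) \<in> less4 \<Longrightarrow> p \<in> J \<and> q \<in> J"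
  by (auto simp: quadratic_order_def)

lemma quadratic_order_strict_linear: "strict_linear_order_on J less4"
  unfolding strict_linear_order_on_def
proof (intro conjI)
  show "trans less4"
  proof (rule transI)
    fix p q r assume pq: "(p, q) \<in> less4" and qr: "(q, r) \<in> less4"
    obtain l T where p: "p = (arcs l, T)" "jaeger_at l T" using JE less4_field[OF pq] by blast
    obtain l' T' where q: "q = (arcs l', T')" "jaeger_at l' T'" using JE less4_field[OF pq] by blast
    obtain l'' T'' where r: "r = (arcs l'', T'')" "jaeger_at l'' T''" using JE less4_field[OF qr] by blast
    show "(p, r) \<in> less4"
      using pq qr status_less_trans unfolding p q r
      unfolding quadratic_order_iff[OF p(2) q(2)] quadratic_order_iff[OF q(2) r(2)]
        quadratic_order_iff[OF p(2) r(2)] by blast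
  qed
  show "irrefl less4"
  proof (rule irreflI)
    fix p show "(p, p) \<notin> less4"
    proof
      assume pp: "(p, p) \<in> less4"
      obtain l T where p: "p = (arcs l, T)" "jaeger_at l T" using JE less4_field[OF pp] by blast
      show False using pp status_less_irrefl unfolding p quadratic_order_iff[OF p(2) p(2)] by blast
    qed
  qed
  show "total_on J less4"
  proof (rule total_onI)
    fix p q assume pJ: "p \<in> J" and qJ: "q \<in> J" and ne: "p \<noteq> q"
    obtain l T where p: "p = (arcs l, T)" "jaeger_at l T" using JE[OF pJ] .
    obtain l' T' where q: "q = (arcs l', T')" "jaeger_at l' T'" using JE[OF qJ] .
    have "\<not> (T = T' \<and> arcs l = arcs l')" using ne p q by auto
    then show "(p, q) \<in> less4 \<or> (q, p) \<in> less4"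
      unfolding p q quadratic_order_iff[OF p(2) q(2)] quadratic_order_iff[OF q(2) p(2)]
      by (rule status_less_total[OF p(2) q(2)])
  qed
qed

text \<open>Common points of the two simplices have a vanishing coordinate in \<open>T\<close>,
  while all coordinates are positive in the relative interior.\<close>

lemma rel_interior_disjoint:
  assumes J: "jaeger_at l T" and J': "jaeger_at l' T'" and less: "status_less l' T' l T"
  shows "rel_interior (arc_polytope T) \<inter> rel_interior (arc_polytope T') = {}"
proof -
  note tree = jaeger_atD(3)[OF J]
  obtain e where e: "e \<in> T"
    "\<And>x. x \<in> arc_polytope T \<Longrightarrow> x \<in> arc_polytope T' \<Longrightarrow> coord T e x = 0"
    using first_difference_tail_edge[OF J J' less] by metis
  have False if x: "x \<in> rel_interior (arc_polytope T)" "x \<in> rel_interior (arc_polytope T')" for x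
  proof -
    have "x \<in> arc_polytope T" "x \<in> arc_polytope T'" using x rel_interior_subset by blast+
    then have "coord T e x = 0" by (rule e(2))
    moreover have "0 < coord T e x"
      using x(1) e(1) in_rel_interior_arc_polytope_iff[OF tree order_refl] by blast
    ultimately show False by simp
  qed
  then show ?thesis by blast
qed

lemma simplex_arc_polytope:
  assumes "oriented_tree T"
  shows "(int CARD('v) - 2) simplex (arc_polytope T :: (real ^ 'v) set)"
  unfolding simplex_def
proof (intro exI conjI)
  show "\<not> affine_dependent (arc_vec ` T :: (real ^ 'v) set)"
    using affine_independent_arc_vec[OF assms order_refl] .
  have "card (arc_vec ` T :: (real ^ 'v) set) = CARD('v) - 1"
    using card_image[OF inj_on_arc_vec[OF assms]] card_oriented_tree[OF assms] by metis
  then show "int (card (arc_vec ` T :: (real ^ 'v) set)) = int CARD('v) - 2 + 1"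
    by (simp add: of_nat_diff Suc_leI)
  show "arc_polytope T = convex hull (arc_vec ` T)" by (rule arc_polytope_eq)
qed

abbreviation Q :: "'v rel \<times> 'v rel \<Rightarrow> (real ^ 'v) set" where
  "Q \<equiv> \<lambda>(G, T). arc_polytope T"

lemma jaeger_dissection:
  "dissection (int CARD('v) - 2) J Q (rel_frontier (root_polytope E))"
  unfolding dissection_def
proof (intro conjI)
  show "finite J" by simp
  show "\<forall>p\<in>J. (int CARD('v) - 2) simplex (Q p)"
  proof
    fix p assume "p \<in> J"
    then obtain l T where "p = (arcs l, T)" "jaeger_at l T" using JE by blast
    then show "(int CARD('v) - 2) simplex (Q p)"
      using simplex_arc_polytope[of T] jaeger_atD(3) by simp
  qed
  show "(\<Union>p\<in>J. Q p) = rel_frontier (root_polytope E)"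
  proof (intro equalityI subsetI)
    fix x :: "real ^ 'v" assume "x \<in> (\<Union>p\<in>J. Q p)"
    then obtain p where p: "p \<in> J" "x \<in> (Q p)" by blast
    obtain l T where "p = (arcs l, T)" "jaeger_at l T" using JE[OF p(1)] .
    then show "x \<in> rel_frontier (root_polytope E)" using p(2) arc_polytope_subset_rel_frontier by auto
  next
    fix x :: "real ^ 'v" assume "x \<in> rel_frontier (root_polytope E)"
    then obtain l T where "jaeger_at l T" "x \<in> arc_polytope T" using jaeger_cover by blast
    then show "x \<in> (\<Union>p\<in>J. Q p)"
      using JI by (intro UN_I[of "(arcs l, T)"]) auto
  qed
  show "pairwise (\<lambda>p q. rel_interior (Q p) \<inter>
      rel_interior (Q q) = {}) J"
  proof (rule pairwiseI)
    fix p q assume pJ: "p \<in> J" and qJ: "q \<in> J" and ne: "p \<noteq> q"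
    obtain l T where p: "p = (arcs l, T)" "jaeger_at l T" using JE[OF pJ] .
    obtain l' T' where q: "q = (arcs l', T')" "jaeger_at l' T'" using JE[OF qJ] .
    have "\<not> (T = T' \<and> arcs l = arcs l')" using ne p q by auto
    then have "status_less l T l' T' \<or> status_less l' T' l T" by (rule status_less_total[OF p(2) q(2)])
    then show "rel_interior (Q p) \<inter>
      rel_interior (Q q) = {}"
      using rel_interior_disjoint[OF p(2) q(2)] rel_interior_disjoint[OF q(2) p(2)] p(1) q(1) by auto
  qed
qed

section \<open>Intersections with earlier simplices\<close>

text \<open>For a tree with a single arc, the facet is empty and has affine dimension -1, as
  \<open>simplex_facet\<close> allows.\<close>

lemma simplex_facet_arc_polytope:
  assumes T: "oriented_tree T" and e: "e \<in> T"
  shows "simplex_facet (arc_polytope (T - {e}) :: (real ^ 'v) set) (arc_polytope T)"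
  unfolding simplex_facet_def
proof
  have ind: "\<not> affine_dependent (arc_vec ` T :: (real ^ 'v) set)"
    using affine_independent_arc_vec[OF T order_refl] .
  show "(arc_polytope (T - {e}) :: (real ^ 'v) set) face_of arc_polytope T"
    unfolding arc_polytope_eq
    by (rule face_of_convex_hull_affine_independent[OF ind, THEN iffD2])
      (intro exI[of _ "arc_vec ` (T - {e})"] conjI image_mono Diff_subset refl)
  have dim: "aff_dim (arc_polytope A :: (real ^ 'v) set) = int (card A) - 1" if "A \<subseteq> T" for A
    using aff_dim_affine_independent[OF affine_independent_arc_vec[OF T that]]
      card_image[OF inj_on_subset[OF inj_on_arc_vec[OF T] that]]
    by (simp add: arc_polytope_eq aff_dim_convex_hull)
  have "card T = Suc (card (T - {e}))" using e by (metis card.remove finite)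
  then show "aff_dim (arc_polytope (T - {e}) :: (real ^ 'v) set) = aff_dim (arc_polytope T :: (real ^ 'v) set) - 1"
    using dim[of T] dim[of "T - {e}"] by auto
qed

lemma in_tail_facet:
  assumes "oriented_tree T" "e \<in> T" "x \<in> arc_polytope T" "coord T e x = 0"
  shows "x \<in> arc_polytope (T - {e})"
  using assms(2-4) in_arc_polytope_iff[OF assms(1) order_refl, of x]
    in_arc_polytope_iff[OF assms(1), of "T - {e}" x] by auto

definition tail_facets :: "'v rel \<Rightarrow> (real ^ 'v) set set" where
  "tail_facets T = {arc_polytope (T - {e}) | e. e \<in> T \<and> b0 \<notin> head_side T e}"

lemma earlier_simplices_inter:
  assumes J: "jaeger_at l T"
  shows "arc_polytope T \<inter> \<Union> {arc_polytope T' | l' T'. jaeger_at l' T' \<and> status_less l' T' l T}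
    = \<Union> (tail_facets T)"
proof (intro equalityI subsetI)
  fix x assume "x \<in> arc_polytope T \<inter> \<Union> {arc_polytope T' | l' T'. jaeger_at l' T' \<and> status_less l' T' l T}"
  then obtain l' T' where x: "x \<in> arc_polytope T" "x \<in> arc_polytope T'"
    and J': "jaeger_at l' T'" "status_less l' T' l T" by blast
  obtain e where e: "e \<in> T" "b0 \<notin> head_side T e"
    "\<And>x. x \<in> arc_polytope T \<Longrightarrow> x \<in> arc_polytope T' \<Longrightarrow> coord T e x = 0"
    using first_difference_tail_edge[OF J J'] by metis
  have "x \<in> arc_polytope (T - {e})" using in_tail_facet[OF jaeger_atD(3)[OF J] e(1) x(1) e(3)[OF x]] .
  then show "x \<in> \<Union> (tail_facets T)" using e(1,2) unfolding tail_facets_def by blast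
next
  fix x assume "x \<in> \<Union> (tail_facets T)"
  then obtain e where e: "e \<in> T" "b0 \<notin> head_side T e" and x: "x \<in> arc_polytope (T - {e})"
    unfolding tail_facets_def by blast
  obtain l' T' where "jaeger_at l' T'" "status_less l' T' l T" "x \<in> arc_polytope T'"
    using tail_facet_covered[OF J e x] .
  moreover have "x \<in> arc_polytope T" using x arc_polytope_mono[of "T - {e}" T] by blast
  ultimately show "x \<in> arc_polytope T \<inter> \<Union> {arc_polytope T' | l' T'. jaeger_at l' T' \<and> status_less l' T' l T}"
    by blast
qed

lemma quadratic_order_shelling:
  assumes xs: "distinct xs" "set xs = J" "sorted_wrt (\<lambda>p q. (p, q) \<in> less4) xs"
  shows "shelling_order (map Q xs)"
  unfolding shelling_order_def
proof (intro allI impI)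
  fix i assume "1 \<le> i \<and> i < length (map Q xs)"
  then have i: "1 \<le> i" "i < length xs" by simp_all
  have "xs ! i \<in> J" using i xs(2) nth_mem by blast
  then obtain l T where lT: "xs ! i = (arcs l, T)" "jaeger_at l T" using JE by blast
  have earlier: "\<exists>l' T'. xs ! j = (arcs l', T') \<and> jaeger_at l' T' \<and> status_less l' T' l T"
    if "j < i" for j
  proof -
    have "xs ! j \<in> J" using that i xs(2) nth_mem by (metis order_less_trans)
    then obtain l' T' where lT': "xs ! j = (arcs l', T')" "jaeger_at l' T'" using JE by blast
    have "(xs ! j, xs ! i) \<in> less4" using sorted_wrt_nth_less[OF xs(3) that i(2)] .
    then show ?thesis using quadratic_order_iff[OF lT'(2) lT(2)] lT(1) lT' by auto
  qed
  have "(\<Union>j<i. map Q xs ! j)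
      = \<Union> {arc_polytope T' | l' T'. jaeger_at l' T' \<and> status_less l' T' l T}" (is "_ = ?U")
  proof (intro equalityI subsetI)
    fix x assume "x \<in> (\<Union>j<i. map Q xs ! j)"
    then obtain j where j: "j < i" "x \<in> Q (xs ! j)" using i by auto
    obtain l' T' where lT': "xs ! j = (arcs l', T')" "jaeger_at l' T'" "status_less l' T' l T"
      using earlier[OF j(1)] by blast
    then have "x \<in> arc_polytope T'" using j(2) by simp
    then show "x \<in> ?U" using lT'(2,3) by blast
  next
    fix x assume "x \<in> ?U"
    then obtain l' T' where x: "x \<in> arc_polytope T'" and lT': "jaeger_at l' T'" "status_less l' T' l T"
      by blast
    have less: "((arcs l', T'), xs ! i) \<in> less4" using quadratic_order_iff[OF lT'(1) lT(2)] lT lT' by simp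
    obtain j where j: "j < length xs" "xs ! j = (arcs l', T')"
      using JI[OF lT'(1)] xs(2) by (metis in_set_conv_nth)
    \<comment> \<open>Otherwise sortedness and transitivity would place \<open>xs ! i\<close> before
      itself.\<close>
    have "j < i"
    proof (rule ccontr)
      assume "\<not> j < i"
      then consider "j = i" | "i < j" by linarith
      then have "(xs ! i, xs ! i) \<in> less4"
      proof cases
        case 1
        then show ?thesis using less j by simp
      next
        case 2
        then have "(xs ! i, xs ! j) \<in> less4" using sorted_wrt_nth_less[OF xs(3) _ j(1)] by blast
        then show ?thesis using less j quadratic_order_strict_linear
          unfolding strict_linear_order_on_def by (metis transD)
      qed
      then show False using quadratic_order_strict_linear
        unfolding strict_linear_order_on_def irrefl_def by blast
    qed
    then show "x \<in> (\<Union>j<i. map Q xs ! j)" using x j by (intro UN_I[of j]) auto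
  qed
  then have "map Q xs ! i \<inter> (\<Union>j<i. map Q xs ! j) = \<Union> (tail_facets T)"
    using earlier_simplices_inter[OF lT(2)] lT(1) i(2) by simp
  \<comment> \<open>As \<open>i\<close> is at least 1, there is an earlier simplex, and the first
    difference from it exhibits a tail-edge.\<close>
  moreover have "tail_facets T \<noteq> {}"
  proof -
    obtain l' T' where "jaeger_at l' T'" "status_less l' T' l T" using earlier[of 0] i by auto
    then obtain e where "e \<in> T" "b0 \<notin> head_side T e"
      using first_difference_tail_edge[OF lT(2)] by metis
    then show ?thesis unfolding tail_facets_def by blast
  qed
  moreover have "\<forall>F\<in>tail_facets T. simplex_facet F (map Q xs ! i)"
    using simplex_facet_arc_polytope[OF jaeger_atD(3)[OF lT(2)]] lT(1) i(2)
    unfolding tail_facets_def by auto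
  ultimately show "\<exists>\<F>. \<F> \<noteq> {} \<and> (\<forall>F\<in>\<F>. simplex_facet F (map Q xs ! i)) \<and>
        map Q xs ! i \<inter> (\<Union>j<i. map Q xs ! j) = \<Union> \<F>" by blast
qed

end

theorem theorem3p12:
  fixes E :: "('v::finite) rel" and rot :: "'v \<Rightarrow> 'v \<Rightarrow> 'v" and b0 b1 :: 'v
  assumes "simple_graph E"
    and "connected_spanning E"
    and "ribbon_structure E rot"
    and "(b0, b1) \<in> E"
  defines "J \<equiv> jaeger_pairs E rot (b0, b1)"
    and "less4 \<equiv> quadratic_order E rot (b0, b1)"
    and "Q \<equiv> \<lambda>(G, T). arc_polytope T"
  shows "dissection (int CARD('v) - 2) J Q (rel_frontier (root_polytope E))
    \<and> strict_linear_order_on J less4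
    \<and> (\<exists>xs. distinct xs \<and> set xs = J \<and> sorted_wrt (\<lambda>p q. (p, q) \<in> less4) xs
          \<and> shelling_order (map Q xs))"
proof -
  interpret ribbon_graph E rot b0 b1
    using assms(1-4) by unfold_locales
  have linear: "strict_linear_order_on J less4"
    unfolding J_def less4_def by (rule quadratic_order_strict_linear)
  moreover obtain xs where xs: "distinct xs" "set xs = J" "sorted_wrt (\<lambda>p q. (p, q) \<in> less4) xs"
    using finite_strict_linear_order_sorted_list[OF _ linear] by auto
  moreover have "shelling_order (map Q xs)"
    using quadratic_order_shelling xs unfolding J_def less4_def Q_def by blast
  moreover have "dissection (int CARD('v) - 2) J Q (rel_frontier (root_polytope E))"
    unfolding J_def Q_def by (rule jaeger_dissection)
  ultimately show ?thesis by blast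
qed

end
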